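(* Let $\mathcal H$ be a separable complex Hilbert space, let $\Omega\subseteq\mathbb C$ be open and connected, and let $A:\Omega\to\mathcal B(\mathcal H)$ be analytic with $A(z)\in\Phi(\mathcal H)$ for all $z\in\Omega$. Let $z_0\in\Omega$ be a pole of $A(\cdot)^{-1}$ of order $n_0\in\mathbb N$. Then there exist projections $\widetilde P_j$ and $\widetilde Q_j=I_{\mathcal H}-\widetilde P_j$ in $\mathcal H$, $1\le j\le n_0$, such that, with $\widetilde p_j=\dim(\operatorname{ran}(\widetilde P_j))$, $$A(z)=\widetilde A_{n_0}(z)\big[\widetilde Q_{n_0}-(z-z_0)\widetilde P_{n_0}\big]\cdots\big[\widetilde Q_2-(z-z_0)\widetilde P_2\big]\big[\widetilde Q_1-(z-z_0)\widetilde P_1\big],\quad z\in\Omega,$$ and $$1\le\widetilde p_{n_0}\le\widetilde p_{n_0-1}\le\cdots\le\widetilde p_2\le\widetilde p_1<\infty,$$ where: (a) $\widetilde A_{n_0}(\cdot)$ is analytic on $\Omega$; (b) $\widetilde A_{n_0}(z)\in\Phi(\mathcal H)$ for all $z\in\Omega$; (c) $\operatorname{ind}(A(z))=\operatorname{ind}(\widetilde A_{n_0}(z))=0$ for $z\in\Omega$ with $|z-z_0|$ sufficiently small; (d) $\widetilde A_{n_0}(z)^{-1}\in\mathcal B(\mathcal H)$ for $z\in\Omega$ with $|z-z_0|$ sufficiently small. In addition, $\widetilde p_1=\dim(\ker(A(z_0)))=m_g(0;A(z_0))$ and hence, with $\widetilde\nu(z_0;A(\cdot)):=\sum_{j=1}^{n_0}\widetilde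 p_j$, $$\widetilde\nu(z_0;A(\cdot))\ge m_g(0;A(z_0)),\qquad\widetilde\nu(z_0;A(\cdot))\ge n_0.$$ Finally, $[I_{\mathcal H}-A(\cdot)]\in\mathcal F(\mathcal H)$ (resp., $\mathcal B_p(\mathcal H)$ for some $1\le p\le\infty$) if and only if $[I_{\mathcal H}-\widetilde A_{n_0}(\cdot)]\in\mathcal F(\mathcal H)$ (resp., $\mathcal B_p(\mathcal H)$, with the same $p$), where membership of such an operator-valued function means membership of its value at every $z\in\Omega$.
   Context: $\mathcal B(\mathcal H)$ denotes the bounded linear operators on $\mathcal H$; $\mathcal F(\mathcal H)$ the finite rank operators; $\mathcal B_p(\mathcal H)$, $1\le p<\infty$, the Schatten--von Neumann ideals; $\mathcal B_\infty(\mathcal H)$ the compact operators. $\Phi(\mathcal H)$ is the set of bounded Fredholm operators ($\dim\ker(T)<\infty$, $\operatorname{ran}(T)$ closed, $\dim\ker(T^* )<\infty$) and $\operatorname{ind}(T)=\dim\ker(T)-\dim\ker(T^* )$. A projection is a bounded idempotent, not necessarily orthogonal. That $z_0$ is a pole of $A(\cdot)^{-1}$ entails that $A(z)$ is boundedly invertible for some $z\in\Omega$, so that by the analytic Fredholm theorem $A(\cdot)^{-1}$ is meromorphic on $\Omega$; the order of the pole refers to the norm convergent Laurent expansion of $A(z)^{-1}$ about $z_0$. The geometric multiplicity is $m_g(0;A(z_0))=\dim(\ker(A(z_0)))$. *)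

theory Defs
  imports "HOL-Analysis.Analysis"
begin

class complex_normed_vector = real_normed_vector +
  fixes scaleC :: "complex \<Rightarrow> 'a \<Rightarrow> 'a"  (infixr "*\<^sub>C" 75)
  assumes scaleC_add_right: "c *\<^sub>C (x + y) = c *\<^sub>C x + c *\<^sub>C y"
    and scaleC_add_left: "(c + d) *\<^sub>C x = c *\<^sub>C x + d *\<^sub>C x"
    and scaleC_scaleC: "c *\<^sub>C d *\<^sub>C x = (c * d) *\<^sub>C x"
    and scaleC_of_real: "complex_of_real r *\<^sub>C x = r *\<^sub>R x"
    and norm_scaleC: "norm (c *\<^sub>C x) = cmod c * norm x"

(* The inner product is linear in the second and antilinear in the first argument. *)
class complex_inner = complex_normed_vector +
  fixes cinner :: "'a \<Rightarrow> 'a \<Rightarrow> complex"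
  assumes cinner_commute: "cinner x y = cnj (cinner y x)"
    and cinner_add_right: "cinner x (y + z) = cinner x y + cinner x z"
    and cinner_scaleC_right: "cinner x (c *\<^sub>C y) = c * cinner x y"
    and cinner_self: "cinner x x = complex_of_real ((norm x)\<^sup>2)"

class chilbert_space = complex_inner + banach

instantiation complex :: chilbert_space
begin
definition scaleC_complex :: "complex \<Rightarrow> complex \<Rightarrow> complex"
  where "scaleC_complex c x = c * x"
definition cinner_complex :: "complex \<Rightarrow> complex \<Rightarrow> complex"
  where "cinner_complex x y = cnj x * y"
instance
proof
  fix c d x y z :: complex and r :: real
  show "c *\<^sub>C (x + y) = c *\<^sub>C x + c *\<^sub>C y"
    and "(c + d) *\<^sub>C x = c *\<^sub>C x + d *\<^sub>C x"
    and "c *\<^sub>C d *\<^sub>C x = (c * d) *\<^sub>C x"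
    and "complex_of_real r *\<^sub>C x = r *\<^sub>R x"
    and "norm (c *\<^sub>C x) = cmod c * norm x"
    by (simp_all add: scaleC_complex_def algebra_simps norm_mult scaleR_conv_of_real)
  show "cinner x y = cnj (cinner y x)"
    and "cinner x (y + z) = cinner x y + cinner x z"
    and "cinner x (c *\<^sub>C y) = c * cinner x y"
    by (simp_all add: cinner_complex_def scaleC_complex_def algebra_simps)
  show "cinner x x = complex_of_real ((norm x)\<^sup>2)"
    using complex_norm_square[of x] by (simp add: cinner_complex_def mult.commute)
qed
end

global_interpretation complex_vector:
  vector_space "scaleC :: complex \<Rightarrow> 'a \<Rightarrow> 'a::complex_normed_vector"
  by standard
    (use scaleC_of_real[of 1] in \<open>simp_all add: scaleC_add_right scaleC_add_left scaleC_scaleC\<close>)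

(* complex_vector.dim is 0 on infinite-dimensional subspaces, so dim < infinity
   has to be expressed separately. *)
definition finite_cdim :: "'a::complex_normed_vector set \<Rightarrow> bool"
  where "finite_cdim V \<longleftrightarrow> (\<exists>B. finite B \<and> V \<subseteq> complex_vector.span B)"

lemma bounded_linear_scaleC_comp:
  fixes T :: "'a::real_normed_vector \<Rightarrow> 'b::complex_normed_vector"
  assumes "bounded_linear T"
  shows "bounded_linear (\<lambda>x. c *\<^sub>C T x)"
proof -
  interpret T: bounded_linear T by fact
  obtain K where K: "\<And>x. norm (T x) \<le> norm x * K" using T.bounded by blast
  have sc: "c *\<^sub>C (r *\<^sub>R y) = r *\<^sub>R (c *\<^sub>C y)" for r and y :: 'b
    by (simp add: scaleC_of_real[symmetric] scaleC_scaleC mult.commute)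
  show ?thesis
  proof (rule bounded_linear_intro[where K = "cmod c * K"])
    show "norm (c *\<^sub>C T x) \<le> norm x * (cmod c * K)" for x
      using mult_left_mono[OF K[of x] norm_ge_zero[of c]] by (simp add: norm_scaleC mult_ac)
  qed (simp_all add: T.add T.scaleR scaleC_add_right sc)
qed

instantiation blinfun :: (real_normed_vector, complex_normed_vector) complex_normed_vector
begin
lift_definition scaleC_blinfun :: "complex \<Rightarrow> ('a \<Rightarrow>\<^sub>L 'b) \<Rightarrow> ('a \<Rightarrow>\<^sub>L 'b)"
  is "\<lambda>c T x. c *\<^sub>C T x"
  by (rule bounded_linear_scaleC_comp)
instance
proof
  fix c d :: complex and r :: real and S T :: "'a \<Rightarrow>\<^sub>L 'b"
  show "c *\<^sub>C (S + T) = c *\<^sub>C S + c *\<^sub>C T"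
    by transfer (simp add: scaleC_add_right)
  show "(c + d) *\<^sub>C T = c *\<^sub>C T + d *\<^sub>C T"
    by transfer (simp add: scaleC_add_left)
  show "c *\<^sub>C d *\<^sub>C T = (c * d) *\<^sub>C T"
    by transfer (simp add: scaleC_scaleC)
  show "complex_of_real r *\<^sub>C T = r *\<^sub>R T"
    by transfer (simp add: scaleC_of_real)
  have ap: "blinfun_apply (c *\<^sub>C T) x = c *\<^sub>C blinfun_apply T x" for c x and T :: "'a \<Rightarrow>\<^sub>L 'b"
    by transfer simp
  have le: "norm (c *\<^sub>C T) \<le> cmod c * norm T" for c and T :: "'a \<Rightarrow>\<^sub>L 'b"
    by (rule norm_blinfun_bound)
      (auto simp: ap norm_scaleC mult.assoc intro!: mult_left_mono norm_blinfun)
  show "norm (c *\<^sub>C T) = cmod c * norm T"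
  proof (cases "c = 0")
    case True
    then show ?thesis using le[of 0 T] by simp
  next
    case False
    have "inverse c *\<^sub>C c *\<^sub>C T = T"
      by (rule blinfun_eqI) (use False scaleC_of_real[of 1] in \<open>simp add: ap scaleC_scaleC\<close>)
    with le[of "inverse c" "c *\<^sub>C T"] have "norm T \<le> inverse (cmod c) * norm (c *\<^sub>C T)"
      by (simp add: norm_inverse)
    with False have "cmod c * norm T \<le> norm (c *\<^sub>C T)"
      by (simp add: field_simps)
    with le[of c T] show ?thesis by simp
  qed
qed
end

(* Elements of 'a \<Rightarrow>\<^sub>L 'a are only real-linear; bounded_ops is B(H), the algebra of
   complex-linear ones, with the operator norm inherited from blinfun. *)
definition bounded_ops :: "('a::chilbert_space \<Rightarrow>\<^sub>L 'a) set"
  where "bounded_ops = {T :: 'a \<Rightarrow>\<^sub>L 'a. \<forall>c x. T (c *\<^sub>C x) = c *\<^sub>C T x}"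

definition op_ker :: "('a::chilbert_space \<Rightarrow>\<^sub>L 'a) \<Rightarrow> 'a set"
  where "op_ker T = {x. T x = 0}"

definition op_ran :: "('a::chilbert_space \<Rightarrow>\<^sub>L 'a) \<Rightarrow> 'a set"
  where "op_ran T = range (blinfun_apply T)"

(* The Hilbert space adjoint; it exists for T in bounded_ops by the Riesz representation theorem. *)
definition cadjoint :: "('a::chilbert_space \<Rightarrow>\<^sub>L 'a) \<Rightarrow> 'a \<Rightarrow>\<^sub>L 'a"
  where "cadjoint T = (THE S :: 'a \<Rightarrow>\<^sub>L 'a. \<forall>x y. cinner (S x) y = cinner x (T y))"

definition geo_mult :: "complex \<Rightarrow> ('a::chilbert_space \<Rightarrow>\<^sub>L 'a) \<Rightarrow> nat"
  where "geo_mult \<mu> T = complex_vector.dim (op_ker (T - \<mu> *\<^sub>C id_blinfun))"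

definition fredholm_ops :: "('a::chilbert_space \<Rightarrow>\<^sub>L 'a) set"
  where "fredholm_ops =
    {T \<in> bounded_ops. finite_cdim (op_ker T) \<and> closed (op_ran T) \<and> finite_cdim (op_ker (cadjoint T))}"

definition op_index :: "('a::chilbert_space \<Rightarrow>\<^sub>L 'a) \<Rightarrow> int"
  where "op_index T = int (complex_vector.dim (op_ker T)) - int (complex_vector.dim (op_ker (cadjoint T)))"

definition finite_rank_ops :: "('a::chilbert_space \<Rightarrow>\<^sub>L 'a) set"
  where "finite_rank_ops = {T \<in> bounded_ops. finite_cdim (op_ran T)}"

definition compact_ops :: "('a::chilbert_space \<Rightarrow>\<^sub>L 'a) set"
  where "compact_ops = {T \<in> bounded_ops. compact (closure (T ` cball 0 1))}"

(* The singular values of T are the s > 0 such that s^2 is an eigenvalue of T*T, repeated according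
   to multiplicity; T belongs to the class B_p iff they are p-summable. *)
definition schatten_ops :: "real \<Rightarrow> ('a::chilbert_space \<Rightarrow>\<^sub>L 'a) set"
  where "schatten_ops p = {T \<in> compact_ops.
    (\<lambda>s. real (geo_mult (complex_of_real (s\<^sup>2)) (cadjoint T o\<^sub>L T)) * s powr p) summable_on {0<..}}"

definition projections :: "('a::chilbert_space \<Rightarrow>\<^sub>L 'a) set"
  where "projections = {P \<in> bounded_ops. P o\<^sub>L P = P}"

definition is_inverse :: "('a::chilbert_space \<Rightarrow>\<^sub>L 'a) \<Rightarrow> ('a \<Rightarrow>\<^sub>L 'a) \<Rightarrow> bool"
  where "is_inverse T S \<longleftrightarrow> S \<in> bounded_ops \<and> S o\<^sub>L T = id_blinfun \<and> T o\<^sub>L S = id_blinfun"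

definition boundedly_invertible :: "('a::chilbert_space \<Rightarrow>\<^sub>L 'a) \<Rightarrow> bool"
  where "boundedly_invertible T \<longleftrightarrow> (\<exists>S. is_inverse T S)"

definition op_inverse :: "('a::chilbert_space \<Rightarrow>\<^sub>L 'a) \<Rightarrow> 'a \<Rightarrow>\<^sub>L 'a"
  where "op_inverse T = (THE S. is_inverse T S)"

definition op_analytic_on :: "(complex \<Rightarrow> 'a::chilbert_space \<Rightarrow>\<^sub>L 'a) \<Rightarrow> complex set \<Rightarrow> bool"
  where "op_analytic_on F \<Omega> \<longleftrightarrow>
    (\<forall>z\<in>\<Omega>. \<exists>r>0. \<exists>C. ball z r \<subseteq> \<Omega> \<and> range C \<subseteq> bounded_ops \<and>
       (\<forall>w\<in>ball z r. (\<lambda>k. (w - z) ^ k *\<^sub>C C k) sums F w))"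

(* The Laurent coefficient of (w - z)^m is C (m + n), so C 0 is the leading one. *)
definition op_pole_of_order ::
    "(complex \<Rightarrow> 'a::chilbert_space \<Rightarrow>\<^sub>L 'a) \<Rightarrow> complex \<Rightarrow> nat \<Rightarrow> bool"
  where "op_pole_of_order F z n \<longleftrightarrow> 0 < n \<and>
    (\<exists>r>0. \<exists>C. range C \<subseteq> bounded_ops \<and> C 0 \<noteq> 0 \<and>
       (\<forall>w\<in>ball z r - {z}. (\<lambda>k. (w - z) powi (int k - int n) *\<^sub>C C k) sums F w))"

(* op_inverse is meaningful only at invertible operators, hence the first conjunct. *)
definition inverse_pole_of_order ::
    "(complex \<Rightarrow> 'a::chilbert_space \<Rightarrow>\<^sub>L 'a) \<Rightarrow> complex \<Rightarrow> nat \<Rightarrow> bool"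
  where "inverse_pole_of_order A z n \<longleftrightarrow>
    (\<forall>\<^sub>F w in at z. boundedly_invertible (A w)) \<and> op_pole_of_order (\<lambda>w. op_inverse (A w)) z n"

(* factor_prod P Q c n = [Q_n - c P_n] ... [Q_2 - c P_2] [Q_1 - c P_1] *)
primrec factor_prod ::
    "(nat \<Rightarrow> 'a::chilbert_space \<Rightarrow>\<^sub>L 'a) \<Rightarrow> (nat \<Rightarrow> 'a \<Rightarrow>\<^sub>L 'a) \<Rightarrow> complex \<Rightarrow> nat \<Rightarrow> 'a \<Rightarrow>\<^sub>L 'a"
  where
    "factor_prod P Q c 0 = id_blinfun"
  | "factor_prod P Q c (Suc n) = (Q (Suc n) - c *\<^sub>C P (Suc n)) o\<^sub>L factor_prod P Q c n"

end

theory Submission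
  imports Defs
begin

text \<open>Let \<open>P\<close> be the orthogonal projection onto \<open>ker A(z\<^sub>0)\<close> and \<open>Q = I - P\<close>. Since \<open>A(z\<^sub>0) P = 0\<close>,
  the function \<open>A\<^sub>1(z) = A(z) [Q - (z - z\<^sub>0)\<^sup>-\<^sup>1 P]\<close> is analytic, and
  \<open>A(z) = A\<^sub>1(z) [Q - (z - z\<^sub>0) P]\<close>. The leading Laurent coefficient of the inverse of \<open>A\<close> has its range in
  \<open>ker A(z\<^sub>0)\<close>, so the pole of the inverse of \<open>A\<^sub>1\<close> has order one less; and \<open>P\<close> maps \<open>ker A\<^sub>1(z\<^sub>0)\<close>
  injectively into \<open>ker A(z\<^sub>0)\<close>. After as many steps as the order of the pole, an analytic function with
  invertible value at \<open>z\<^sub>0\<close> remains. The product of the factors is a finite rank perturbation of \<open>I\<close>, so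
  near \<open>z\<^sub>0\<close> the operator \<open>A(z)\<close> is an invertible operator times a finite rank perturbation of \<open>I\<close> and has
  index \<open>0\<close>; also \<open>I - A\<close> and \<open>I - A\<^sub>n\<close> differ by finite rank operators, which do not affect membership in
  the Schatten classes.\<close>

section \<open>Hilbert space geometry\<close>

text \<open>The pole order has to drop by exactly one at each step: a positive order is what makes
  the kernel nontrivial, so that every rank is at least one, and an invertible value at the center
  is reached only at order zero. The induction therefore carries the regular part \<open>D\<close>
  of the inverse, with \<open>D z\<^sub>0\<close> nonzero, instead of a Laurent series; at order
  zero it simply is an inverse. The longest detour is the stability of the Schatten classes. They
  are given by multiplicities of eigenvalues, and a finite rank summand can move every single
  eigenvalue. Only a count is stable: the number of singular values at or above a threshold t grows
  by at most a constant that does not depend on t. The singular vectors needed for this come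
  straight from compactness. All comparisons of dimensions (kernels along the splitting, kernel and
  adjoint kernel, singular values) rest on one fact: a space whose dimension exceeds the number of
  linear conditions contains a nonzero vector that satisfies them.\<close>

lemma cinner_add_left: "cinner (x + y) z = cinner x z + cinner y z"
  for x y z :: "'a::complex_inner"
  by (metis cinner_add_right cinner_commute complex_cnj_add)

lemma cinner_scaleC_left: "cinner (c *\<^sub>C x) y = cnj c * cinner x y"
  for x y :: "'a::complex_inner"
  by (metis cinner_commute cinner_scaleC_right complex_cnj_mult)

lemma cinner_zero_left [simp]: "cinner 0 x = 0"
  for x :: "'a::complex_inner"
  using cinner_scaleC_left[of 0 0 x] by simp

lemma cinner_zero_right [simp]: "cinner x 0 = 0"
  for x :: "'a::complex_inner"
  using cinner_scaleC_right[of x 0 0] by simp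

lemma cinner_minus_right: "cinner x (- y) = - cinner x y"
  for x y :: "'a::complex_inner"
  using cinner_add_right[of x y "- y"] by (simp add: add_eq_0_iff)

lemma cinner_diff_right: "cinner x (y - z) = cinner x y - cinner x z"
  for x y z :: "'a::complex_inner"
  using cinner_add_right[of x y "- z"] by (simp add: cinner_minus_right)

lemma cinner_diff_left: "cinner (x - y) z = cinner x z - cinner y z"
  for x y z :: "'a::complex_inner"
  by (metis cinner_commute cinner_diff_right complex_cnj_diff)

lemma cinner_scaleR_right: "cinner x (r *\<^sub>R y) = complex_of_real r * cinner x y"
  for x y :: "'a::complex_inner"
  by (metis cinner_scaleC_right scaleC_of_real)

lemma cinner_sum_right: "cinner x (sum f A) = (\<Sum>a\<in>A. cinner x (f a))"
  for x :: "'a::complex_inner"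
  by (induction A rule: infinite_finite_induct) (simp_all add: cinner_add_right)

lemma cinner_sum_left: "cinner (sum f A) x = (\<Sum>a\<in>A. cinner (f a) x)"
  for x :: "'a::complex_inner"
  by (induction A rule: infinite_finite_induct) (simp_all add: cinner_add_left)

lemma cinner_eq_0_commute: "cinner x y = 0 \<longleftrightarrow> cinner y x = 0"
  for x y :: "'a::complex_inner"
  by (metis cinner_commute complex_cnj_zero)

lemma norm_sq_eq_cinner: "(norm x)\<^sup>2 = Re (cinner x x)"
  for x :: "'a::complex_inner"
  by (simp add: cinner_self)

lemma cinner_eq_zero_iff: "cinner x x = 0 \<longleftrightarrow> x = 0"
  for x :: "'a::complex_inner"
  by (simp add: cinner_self)

lemma cinner_ext:
  fixes x y :: "'a::complex_inner"
  assumes "\<And>z. cinner x z = cinner y z"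
  shows "x = y"
proof -
  have "cinner (x - y) (x - y) = 0"
    using assms by (simp add: cinner_diff_left)
  then show ?thesis by (simp add: cinner_eq_zero_iff)
qed

lemma norm_sq_diff: "(norm (x - y))\<^sup>2 = (norm x)\<^sup>2 - 2 * Re (cinner x y) + (norm y)\<^sup>2"
  for x y :: "'a::complex_inner"
  using arg_cong[OF cinner_commute[of x y], of Re]
  by (simp add: norm_sq_eq_cinner cinner_diff_left cinner_diff_right)

lemma norm_sq_add: "(norm (x + y))\<^sup>2 = (norm x)\<^sup>2 + 2 * Re (cinner x y) + (norm y)\<^sup>2"
  for x y :: "'a::complex_inner"
  using arg_cong[OF cinner_commute[of x y], of Re]
  by (simp add: norm_sq_eq_cinner cinner_add_left cinner_add_right)

text \<open>The squared distance from \<open>x\<close> to the line through \<open>y\<close>. Its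
  nonnegativity is Cauchy--Schwarz, and in the Riesz argument it shows that a vector of minimal norm
  is orthogonal to the kernel.\<close>

lemma norm_sq_sub_component:
  fixes x y :: "'a::complex_inner"
  assumes "y \<noteq> 0"
  shows "(norm (x - (cinner y x / complex_of_real ((norm y)\<^sup>2)) *\<^sub>C y))\<^sup>2
    = (norm x)\<^sup>2 - (cmod (cinner y x))\<^sup>2 / (norm y)\<^sup>2"
proof -
  define k where "k = cinner y x"
  define n where "n = (norm y)\<^sup>2"
  have n: "n > 0" using assms by (simp add: n_def)
  have "Re (cinner x ((k / complex_of_real n) *\<^sub>C y)) = (cmod k)\<^sup>2 / n"
    using cinner_commute[of x y]
    by (simp add: cinner_scaleC_right k_def[symmetric] complex_norm_square[symmetric])
  moreover have "(norm ((k / complex_of_real n) *\<^sub>C y))\<^sup>2 = (cmod k)\<^sup>2 / n"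
  proof -
    have "(norm ((k / complex_of_real n) *\<^sub>C y))\<^sup>2 = (cmod k)\<^sup>2 / n\<^sup>2 * n"
      using n by (simp add: norm_scaleC power_mult_distrib norm_divide n_def power_divide norm_power)
    then show ?thesis using n by (simp add: power2_eq_square)
  qed
  ultimately show ?thesis
    unfolding k_def[symmetric] n_def[symmetric] norm_sq_diff by (simp add: n_def)
qed

lemma cauchy_schwarz: "cmod (cinner x y) \<le> norm x * norm y"
  for x y :: "'a::complex_inner"
proof (cases "x = 0")
  case False
  have "0 \<le> (norm y)\<^sup>2 - (cmod (cinner x y))\<^sup>2 / (norm x)\<^sup>2"
    using norm_sq_sub_component[OF False, of y] by (metis zero_le_power2)
  then have "(cmod (cinner x y))\<^sup>2 \<le> (norm x * norm y)\<^sup>2"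
    using False by (simp add: field_simps power_mult_distrib)
  then show ?thesis by (rule power2_le_imp_le) simp
qed simp

lemma bounded_linear_cinner_right: "bounded_linear (cinner x)"
  for x :: "'a::complex_inner"
  by (rule bounded_linear_intro[where K = "norm x"])
    (use cauchy_schwarz[of x] in \<open>simp_all add: cinner_add_right cinner_scaleR_right
      scaleR_conv_of_real mult.commute\<close>)

subsection \<open>Orthonormal sets\<close>

definition orthonormal :: "'a::complex_inner set \<Rightarrow> bool"
  where "orthonormal B \<longleftrightarrow> (\<forall>x\<in>B. \<forall>y\<in>B. cinner x y = (if x = y then 1 else 0))"

definition orth_proj :: "'a::complex_inner set \<Rightarrow> 'a \<Rightarrow> 'a"
  where "orth_proj B x = (\<Sum>b\<in>B. cinner b x *\<^sub>C b)"

lemma orthonormal_norm: "orthonormal B \<Longrightarrow> b \<in> B \<Longrightarrow> norm b = 1"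
proof -
  assume "orthonormal B" "b \<in> B"
  then have "(norm b)\<^sup>2 = 1" by (simp add: norm_sq_eq_cinner orthonormal_def)
  then show ?thesis by (simp add: power2_eq_1_iff) (smt (verit) norm_ge_zero)
qed

lemma orth_proj_in_span: "orth_proj B x \<in> complex_vector.span B"
  unfolding orth_proj_def
  by (intro complex_vector.span_sum complex_vector.span_scale complex_vector.span_base)

lemma cinner_orth_proj:
  assumes "finite B" "orthonormal B" "b \<in> B"
  shows "cinner b (orth_proj B x) = cinner b x"
proof -
  have "cinner b (orth_proj B x) = (\<Sum>c\<in>B. if b = c then cinner c x else 0)"
    unfolding orth_proj_def cinner_sum_right cinner_scaleC_right
    using assms by (intro sum.cong) (auto simp: orthonormal_def)
  then show ?thesis using assms by simp
qed

lemma cinner_orth_span: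
  assumes "\<And>b. b \<in> B \<Longrightarrow> cinner h b = 0" and "x \<in> complex_vector.span B"
  shows "cinner h x = 0"
  using assms(2) by (induction rule: complex_vector.span_induct_alt)
    (simp_all add: assms(1) cinner_add_right cinner_scaleC_right)

lemma orth_span_eq_0:
  assumes "x \<in> complex_vector.span B" and "\<And>b. b \<in> B \<Longrightarrow> cinner b x = 0"
  shows "x = 0"
proof -
  have "cinner x x = 0"
    by (rule cinner_orth_span[OF _ assms(1)]) (use assms(2) cinner_eq_0_commute in blast)
  then show ?thesis by (simp add: cinner_eq_zero_iff)
qed

lemma orth_proj_eq:
  assumes "finite B" "orthonormal B" "x \<in> complex_vector.span B"
  shows "orth_proj B x = x"
proof -
  have "orth_proj B x - x = 0"
    by (rule orth_span_eq_0[of _ B])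
      (simp_all add: cinner_diff_right cinner_orth_proj assms
        complex_vector.span_diff orth_proj_in_span)
  then show ?thesis by simp
qed

lemma orthonormal_independent:
  assumes "orthonormal B"
  shows "\<not> complex_vector.dependent B"
  unfolding complex_vector.dependent_def
proof
  assume "\<exists>a\<in>B. a \<in> complex_vector.span (B - {a})"
  then obtain a where a: "a \<in> B" "a \<in> complex_vector.span (B - {a})" by blast
  have "a = 0"
    by (rule orth_span_eq_0[OF a(2)]) (use assms a(1) in \<open>auto simp: orthonormal_def\<close>)
  then show False using orthonormal_norm[OF assms a(1)] by simp
qed

text \<open>Gram--Schmidt, one vector of \<open>S\<close> at a time. \<open>B\<close> survives
  inside \<open>C\<close>, because the count for the adjoint kernel needs a basis of a larger space
  that contains a basis of this kernel.\<close>

lemma orthonormal_extend: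
  assumes "finite S" "finite B" "orthonormal B"
  shows "\<exists>C. finite C \<and> B \<subseteq> C \<and> orthonormal C \<and> complex_vector.span C = complex_vector.span (B \<union> S)"
  using assms(1)
proof induction
  case empty
  then show ?case using assms by (intro exI[of _ B]) auto
next
  case (insert a S)
  then obtain C where C: "finite C" "B \<subseteq> C" "orthonormal C"
    "complex_vector.span C = complex_vector.span (B \<union> S)" by blast
  have span_a: "complex_vector.span (B \<union> insert a S) = complex_vector.span (insert a C)"
    using complex_vector.span_insert[of a "B \<union> S"] complex_vector.span_insert[of a C] C(4) by simp
  define y where "y = a - orth_proj C a"
  show ?case
  proof (cases "y = 0")
    case True
    then have "a \<in> complex_vector.span C" using orth_proj_in_span[of C a] by (simp add: y_def)
    then have "complex_vector.span (insert a C) = complex_vector.span C"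
      by (rule complex_vector.span_redundant)
    then show ?thesis using C span_a by metis
  next
    case False
    define u where "u = complex_of_real (inverse (norm y)) *\<^sub>C y"
    have nu: "cinner u u = 1"
      using False by (simp add: u_def cinner_self norm_scaleC norm_inverse del: of_real_inverse)
    have cu: "cinner c u = 0" if "c \<in> C" for c
      using that C by (simp add: u_def y_def cinner_scaleC_right cinner_diff_right cinner_orth_proj)
    have uc: "cinner u c = 0" if "c \<in> C" for c
      using cu[OF that] cinner_eq_0_commute by blast
    have on: "orthonormal (insert u C)"
      using C(3) nu cu uc unfolding orthonormal_def by (metis insert_iff zero_neq_one)
    have uspan: "u \<in> complex_vector.span (insert a C)"
      unfolding u_def y_def
      by (intro complex_vector.span_scale complex_vector.span_diff)
        (auto simp: complex_vector.span_base
          intro: subsetD[OF complex_vector.span_mono orth_proj_in_span])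
    have "y = complex_of_real (norm y) *\<^sub>C u"
      using False by (simp add: u_def complex_vector.scale_scale)
    then have "a = complex_of_real (norm y) *\<^sub>C u + orth_proj C a"
      by (simp add: y_def)
    moreover have "complex_of_real (norm y) *\<^sub>C u + orth_proj C a \<in> complex_vector.span (insert u C)"
      by (intro complex_vector.span_scale complex_vector.span_add)
        (auto simp: complex_vector.span_base
          intro: subsetD[OF complex_vector.span_mono orth_proj_in_span])
    ultimately have "a \<in> complex_vector.span (insert u C)" by metis
    then have "complex_vector.span (insert u C) = complex_vector.span (insert a C)"
      using uspan by (auto simp: complex_vector.span_eq complex_vector.span_base)
    then show ?thesis using C on span_a by (intro exI[of _ "insert u C"]) auto
  qed
qed

lemma orthonormal_basis_exists:
  assumes "complex_vector.subspace V" "finite_cdim V"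
  obtains B where "finite B" "orthonormal B" "complex_vector.span B = V"
    "complex_vector.dim V = card B"
proof -
  obtain S where S: "finite S" "V \<subseteq> complex_vector.span S"
    using assms(2) by (auto simp: finite_cdim_def)
  obtain B where B: "B \<subseteq> V" "\<not> complex_vector.dependent B" "V \<subseteq> complex_vector.span B"
    using complex_vector.basis_exists[of V] by metis
  have "finite B"
    using complex_vector.independent_span_bound[OF S(1) B(2)] B(1) S(2) by blast
  moreover have "complex_vector.span B = V"
    using B assms(1) by (simp add: complex_vector.span_subspace)
  ultimately obtain C where C: "finite C" "orthonormal C" "complex_vector.span C = V"
    using orthonormal_extend[of B "{}"] by (auto simp: orthonormal_def)
  moreover have "complex_vector.dim V = card C"
    using C orthonormal_independent complex_vector.dim_span_eq_card_independent by metis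
  ultimately show ?thesis using that by blast
qed

lemma finite_cdim_span: "finite B \<Longrightarrow> finite_cdim (complex_vector.span B)"
  by (auto simp: finite_cdim_def)

lemma finite_cdim_subset: "finite_cdim V \<Longrightarrow> U \<subseteq> V \<Longrightarrow> finite_cdim U"
  by (auto simp: finite_cdim_def)

text \<open>Only the projections of \<open>H\<close> to the span of \<open>B\<close> matter, and
  they span fewer than \<open>card B\<close> dimensions. A vector of \<open>B\<close> outside that
  span, minus its projection to it, is the witness.\<close>

lemma orthogonal_vector_exists:
  assumes B: "finite B" "orthonormal B" and H: "finite H" "card H < card B"
  obtains x where "x \<in> complex_vector.span B" "x \<noteq> 0" "\<And>h. h \<in> H \<Longrightarrow> cinner h x = 0"
proof -
  obtain C where C: "finite C" "orthonormal C"
    "complex_vector.span C = complex_vector.span (orth_proj B ` H)"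
    using orthonormal_extend[of "orth_proj B ` H" "{}"] H by (auto simp: orthonormal_def)
  have "C \<subseteq> complex_vector.span (orth_proj B ` H)"
    using C(3) complex_vector.span_superset by metis
  then have "card C \<le> card (orth_proj B ` H)"
    using complex_vector.independent_span_bound[OF _ orthonormal_independent[OF C(2)]] H(1) by blast
  then have "card C < card B"
    using card_image_le[OF H(1), of "orth_proj B"] H(2) by linarith
  then have "\<not> B \<subseteq> complex_vector.span C"
    using complex_vector.independent_span_bound[OF C(1) orthonormal_independent[OF B(2)]] by force
  then obtain b where b: "b \<in> B" "b \<notin> complex_vector.span C" by blast
  have CB: "complex_vector.span C \<subseteq> complex_vector.span B"
    unfolding C(3) by (intro complex_vector.span_minimal) (auto simp: orth_proj_in_span)
  define x where "x = b - orth_proj C b"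
  have "x \<noteq> 0" using b(2) orth_proj_in_span[of C b] by (auto simp: x_def)
  moreover have xB: "x \<in> complex_vector.span B"
    unfolding x_def using b(1) CB orth_proj_in_span
    by (intro complex_vector.span_diff) (auto simp: complex_vector.span_base)
  moreover have "cinner h x = 0" if "h \<in> H" for h
  proof -
    have "cinner x c = 0" if "c \<in> C" for c
      using C that cinner_eq_0_commute
      by (fastforce simp: x_def cinner_diff_right cinner_orth_proj)
    then have "cinner x (orth_proj B h) = 0"
      by (rule cinner_orth_span[of C])
        (use that C(3) in \<open>simp_all add: complex_vector.span_base\<close>)
    moreover have "cinner (h - orth_proj B h) x = 0"
    proof (rule cinner_orth_span[OF _ xB])
      fix c assume "c \<in> B"
      then have "cinner c (h - orth_proj B h) = 0"
        using B by (simp add: cinner_diff_right cinner_orth_proj)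
      then show "cinner (h - orth_proj B h) c = 0" using cinner_eq_0_commute by blast
    qed
    ultimately show ?thesis by (simp add: cinner_diff_left) (metis cinner_eq_0_commute)
  qed
  ultimately show ?thesis using that by blast
qed

subsection \<open>Riesz representation and adjoints\<close>

text \<open>By the parallelogram law, the slices of \<open>S\<close> with norm at most d + 1/(n+1)
  have diameters tending to 0; completeness gives them a common point.\<close>

lemma minimal_norm_exists:
  fixes S :: "'a::chilbert_space set"
  assumes "closed S" "convex S" "S \<noteq> {}"
  obtains v where "v \<in> S" "\<And>w. w \<in> S \<Longrightarrow> norm v \<le> norm w"
proof -
  define d where "d = Inf (norm ` S)"
  have d_le: "d \<le> norm w" if "w \<in> S" for w
    unfolding d_def using that by (intro cInf_lower) (auto intro: bdd_belowI[of _ 0])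
  have d0: "0 \<le> d" unfolding d_def using assms(3) by (intro cInf_greatest) auto
  define T where "T n = S \<inter> cball 0 (d + inverse (real (Suc n)))" for n
  have T_ne: "T n \<noteq> {}" for n
  proof -
    have "Inf (norm ` S) < d + inverse (real (Suc n))" by (simp add: d_def)
    then obtain w where "w \<in> S" "norm w < d + inverse (real (Suc n))"
      using assms(3) by (auto dest!: cInf_lessD[rotated])
    then show ?thesis by (auto simp: T_def)
  qed
  have T_mono: "T n \<subseteq> T m" if "m \<le> n" for m n
  proof -
    have "inverse (real (Suc n)) \<le> inverse (real (Suc m))"
      using that by (intro le_imp_inverse_le) auto
    then show ?thesis unfolding T_def by (intro Int_mono subset_refl subset_cball) simp
  qed
  have diam: "(norm (x - y))\<^sup>2 \<le> 4 * ((d + inverse (real (Suc n)))\<^sup>2 - d\<^sup>2)"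
    if "x \<in> T n" "y \<in> T n" for x y n
  proof -
    have "(1/2) *\<^sub>R x + (1/2) *\<^sub>R y \<in> S"
      using that by (intro convexD[OF assms(2)]) (auto simp: T_def)
    then have "d \<le> norm ((1/2) *\<^sub>R (x + y))" using d_le by (metis scaleR_add_right)
    then have "(2 * d)\<^sup>2 \<le> (norm (x + y))\<^sup>2" using d0 by (intro power_mono) auto
    moreover have "(norm x)\<^sup>2 \<le> (d + inverse (real (Suc n)))\<^sup>2"
      and "(norm y)\<^sup>2 \<le> (d + inverse (real (Suc n)))\<^sup>2"
      using that by (auto simp: T_def intro!: power_mono)
    ultimately show ?thesis
      using norm_sq_add[of x y] norm_sq_diff[of x y] by (simp add: power_mult_distrib)
  qed
  have small: "\<exists>n. \<forall>x\<in>T n. \<forall>y\<in>T n. dist x y < e" if "e > 0" for e :: real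
  proof -
    have "(\<lambda>n. 4 * ((d + inverse (real (Suc n)))\<^sup>2 - d\<^sup>2)) \<longlonglongrightarrow> 4 * ((d + 0)\<^sup>2 - d\<^sup>2)"
      by (intro tendsto_intros LIMSEQ_inverse_real_of_nat)
    then have "\<forall>\<^sub>F n in sequentially. 4 * ((d + inverse (real (Suc n)))\<^sup>2 - d\<^sup>2) < e\<^sup>2"
      using that by (intro order_tendstoD(2)) auto
    then obtain n where n: "4 * ((d + inverse (real (Suc n)))\<^sup>2 - d\<^sup>2) < e\<^sup>2"
      by (meson eventually_sequentially order_refl)
    have "dist x y < e" if "x \<in> T n" "y \<in> T n" for x y
      using diam[OF that] n \<open>e > 0\<close>
      by (intro power2_less_imp_less[of _ e]) (auto simp: dist_norm)
    then show ?thesis by blast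
  qed
  obtain v where v: "\<And>n. v \<in> T n"
  proof (rule decreasing_closed_nest[of T])
    show "closed (T n)" for n unfolding T_def by (intro closed_Int assms(1) closed_cball)
  qed (use T_ne T_mono small in \<open>auto simp: dist_commute\<close>)
  have "norm v \<le> d"
  proof (rule LIMSEQ_le_const)
    show "(\<lambda>n. d + inverse (real (Suc n))) \<longlonglongrightarrow> d"
      using tendsto_add[OF tendsto_const LIMSEQ_inverse_real_of_nat, of d] by simp
    show "\<exists>N. \<forall>n\<ge>N. norm v \<le> d + inverse (real (Suc n))"
      using v by (auto simp: T_def)
  qed
  then show ?thesis using that[of v] v[of 0] d_le by (auto simp: T_def intro: order_trans)
qed

text \<open>The vector of least norm on the hyperplane \<open>f x = 1\<close> is orthogonal to the
  kernel of \<open>f\<close>, since otherwise subtracting a component in the kernel would shorten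
  it. A multiple of it represents \<open>f\<close>.\<close>

lemma riesz_representation:
  fixes f :: "'a::chilbert_space \<Rightarrow> complex"
  assumes bl: "bounded_linear f" and sc: "\<And>c x. f (c *\<^sub>C x) = c * f x"
  obtains v where "\<And>x. f x = cinner v x"
proof (cases "\<forall>x. f x = 0")
  case True
  then show ?thesis using that[of 0] by simp
next
  case False
  interpret bounded_linear f by fact
  define S where "S = {x. f x = 1}"
  obtain x0 where "f x0 \<noteq> 0" using False by blast
  then have "f (inverse (f x0) *\<^sub>C x0) = 1" by (simp add: sc)
  then have "S \<noteq> {}" unfolding S_def by blast
  moreover have "closed S"
    unfolding S_def by (intro closed_Collect_eq continuous_intros continuous_on)
  moreover have "convex S"
    by (rule convexI) (simp add: S_def add scaleR scaleR_conv_of_real flip: of_real_add)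
  ultimately obtain v where v: "v \<in> S" "\<And>w. w \<in> S \<Longrightarrow> norm v \<le> norm w"
    using minimal_norm_exists by metis
  have fv: "f v = 1" using v(1) by (simp add: S_def)
  then have v0: "v \<noteq> 0" using zero by auto
  have ker: "cinner v y = 0" if y: "f y = 0" for y
  proof (cases "y = 0")
    case False
    define k where "k = cinner y v / complex_of_real ((norm y)\<^sup>2)"
    have "v - k *\<^sub>C y \<in> S" using y fv by (simp add: S_def diff sc)
    then have "(norm v)\<^sup>2 \<le> (norm (v - k *\<^sub>C y))\<^sup>2" using v(2) by (intro power_mono) auto
    then have "(cmod (cinner y v))\<^sup>2 / (norm y)\<^sup>2 \<le> 0"
      using norm_sq_sub_component[OF False, of v] unfolding k_def by linarith
    then have "cinner y v = 0" using False by (simp add: divide_le_0_iff)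
    then show ?thesis using cinner_eq_0_commute by blast
  qed simp
  have "f x = cinner (complex_of_real (inverse ((norm v)\<^sup>2)) *\<^sub>C v) x" for x
  proof -
    have "cinner v (x - f x *\<^sub>C v) = 0" by (rule ker) (simp add: diff sc fv)
    then have "cinner v x = f x * complex_of_real ((norm v)\<^sup>2)"
      by (simp add: cinner_diff_right cinner_scaleC_right cinner_self)
    then show ?thesis using v0 by (simp add: cinner_scaleC_left)
  qed
  then show ?thesis using that by blast
qed

lemma bounded_ops_scaleC: "T \<in> bounded_ops \<Longrightarrow> T (c *\<^sub>C x) = c *\<^sub>C T x"
  by (simp add: bounded_ops_def)

lemma cadjoint_eqI:
  fixes S T :: "'a::chilbert_space \<Rightarrow>\<^sub>L 'a"
  assumes "\<And>x y. cinner (S x) y = cinner x (T y)"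
  shows "cadjoint T = S"
  unfolding cadjoint_def
proof (rule the_equality)
  fix S' :: "'a \<Rightarrow>\<^sub>L 'a"
  assume "\<forall>x y. cinner (S' x) y = cinner x (T y)"
  then show "S' = S" using assms by - (rule blinfun_eqI, rule cinner_ext, simp)
qed (use assms in blast)

text \<open>Turns the definite description in \<open>cadjoint\<close> into its defining equation.
  Riesz gives the value at each \<open>x\<close>; boundedness follows from writing the squared norm
  of \<open>S x\<close> as the inner product of \<open>x\<close> and \<open>T (S x)\<close>.\<close>

lemma cinner_cadjoint:
  fixes T :: "'a::chilbert_space \<Rightarrow>\<^sub>L 'a"
  assumes "T \<in> bounded_ops"
  shows "cinner (cadjoint T x) y = cinner x (T y)"
proof -
  have "\<exists>v. \<forall>y. cinner x (T y) = cinner v y" for x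
    by (rule riesz_representation[of "\<lambda>y. cinner x (T y)"])
      (auto intro: bounded_linear_compose[OF bounded_linear_cinner_right blinfun.bounded_linear_right]
        simp: bounded_ops_scaleC[OF assms] cinner_scaleC_right)
  then obtain S where S: "\<And>x y. cinner (S x) y = cinner x (T y)" by metis
  have "bounded_linear S"
  proof (rule bounded_linear_intro[where K = "norm T"])
    show "S (x + y) = S x + S y" for x y
      by (rule cinner_ext) (simp add: S cinner_add_left)
    show "S (r *\<^sub>R x) = r *\<^sub>R S x" for r x
      by (rule cinner_ext) (simp add: S cinner_scaleC_left flip: scaleC_of_real)
    show "norm (S x) \<le> norm x * norm T" for x
    proof (cases "S x = 0")
      case False
      have "(norm (S x))\<^sup>2 = Re (cinner x (T (S x)))"
        by (simp add: norm_sq_eq_cinner S)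
      also have "\<dots> \<le> norm x * norm (T (S x))"
        using cauchy_schwarz[of x "T (S x)"] complex_Re_le_cmod order_trans by blast
      also have "\<dots> \<le> norm x * (norm T * norm (S x))"
        by (intro mult_left_mono norm_blinfun) auto
      finally show ?thesis using False by (simp add: power2_eq_square)
    qed simp
  qed
  then have "blinfun_apply (Blinfun S) = S" by (rule bounded_linear_Blinfun_apply)
  then have "cadjoint T = Blinfun S" using S by (intro cadjoint_eqI) simp
  then show ?thesis using S \<open>blinfun_apply (Blinfun S) = S\<close> by simp
qed

lemma cinner_cadjoint_right:
  "T \<in> bounded_ops \<Longrightarrow> cinner y (cadjoint T x) = cinner (T y) x"
  using cinner_cadjoint[of T x y] by (metis cinner_commute)

lemma cadjoint_bounded_ops: "T \<in> bounded_ops \<Longrightarrow> cadjoint T \<in> bounded_ops"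
  unfolding bounded_ops_def mem_Collect_eq
  by (rule allI, rule allI, rule cinner_ext)
    (simp add: cinner_cadjoint cinner_scaleC_left bounded_ops_def)

lemma cadjoint_cadjoint: "T \<in> bounded_ops \<Longrightarrow> cadjoint (cadjoint T) = T"
  by (rule cadjoint_eqI) (simp add: cinner_cadjoint_right)

text \<open>In this form the kernel depends on the range of \<open>T\<close> alone, so composing
  \<open>T\<close> on the right with a surjection does not change it.\<close>

lemma op_ker_cadjoint:
  assumes "T \<in> bounded_ops"
  shows "op_ker (cadjoint T) = {x. \<forall>y. cinner x (T y) = 0}"
  using cinner_ext[of "cadjoint T _" 0] cinner_cadjoint[OF assms]
  by (auto simp: op_ker_def) (metis cinner_zero_left)

section \<open>Finite rank, compact and Fredholm operators\<close>

lemma blinfun_apply_scaleC: "(c *\<^sub>C T) x = c *\<^sub>C T x"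
  for T :: "'a::real_normed_vector \<Rightarrow>\<^sub>L 'b::complex_normed_vector"
  by transfer simp

lemma bounded_ops_add: "S \<in> bounded_ops \<Longrightarrow> T \<in> bounded_ops \<Longrightarrow> S + T \<in> bounded_ops"
  by (simp add: bounded_ops_def blinfun.add_left scaleC_add_right)

lemma bounded_ops_diff: "S \<in> bounded_ops \<Longrightarrow> T \<in> bounded_ops \<Longrightarrow> S - T \<in> bounded_ops"
  by (simp add: bounded_ops_def blinfun.diff_left complex_vector.scale_right_diff_distrib)

lemma bounded_ops_scale: "T \<in> bounded_ops \<Longrightarrow> c *\<^sub>C T \<in> bounded_ops"
  by (simp add: bounded_ops_def blinfun_apply_scaleC scaleC_scaleC mult.commute)

lemma bounded_ops_compose: "S \<in> bounded_ops \<Longrightarrow> T \<in> bounded_ops \<Longrightarrow> S o\<^sub>L T \<in> bounded_ops"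
  by (simp add: bounded_ops_def)

lemma bounded_ops_id: "id_blinfun \<in> bounded_ops"
  by (simp add: bounded_ops_def)

lemma bounded_ops_zero: "0 \<in> bounded_ops"
  by (simp add: bounded_ops_def)

lemma op_ker_subspace: "T \<in> bounded_ops \<Longrightarrow> complex_vector.subspace (op_ker T)"
  by (rule complex_vector.subspaceI) (auto simp: op_ker_def blinfun.add_right bounded_ops_scaleC)

lemma op_ran_subspace: "T \<in> bounded_ops \<Longrightarrow> complex_vector.subspace (op_ran T)"
  by (rule complex_vector.subspaceI)
    (auto simp: op_ran_def simp flip: blinfun.add_right bounded_ops_scaleC intro: range_eqI[of _ _ 0])

lemma cadjoint_compose:
  "S \<in> bounded_ops \<Longrightarrow> T \<in> bounded_ops \<Longrightarrow> cadjoint (S o\<^sub>L T) = cadjoint T o\<^sub>L cadjoint S"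
  by (rule cadjoint_eqI) (simp add: cinner_cadjoint)

lemma cadjoint_id: "cadjoint id_blinfun = id_blinfun"
  by (rule cadjoint_eqI) simp

lemma cadjoint_add:
  "S \<in> bounded_ops \<Longrightarrow> T \<in> bounded_ops \<Longrightarrow> cadjoint (S + T) = cadjoint S + cadjoint T"
  by (rule cadjoint_eqI) (simp add: cinner_cadjoint blinfun.add_left cinner_add_left cinner_add_right)

text \<open>An orthonormal subset of the largest size spans \<open>V\<close>, since Gram--Schmidt
  would enlarge it by any vector outside its span.\<close>

lemma finite_cdim_if_orthonormal_bounded:
  fixes V :: "'a::complex_inner set"
  assumes "complex_vector.subspace V"
    and bd: "\<And>B. finite B \<Longrightarrow> orthonormal B \<Longrightarrow> B \<subseteq> V \<Longrightarrow> card B \<le> N"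
  shows "finite_cdim V"
proof -
  define good where "good B \<longleftrightarrow> finite B \<and> orthonormal B \<and> B \<subseteq> V" for B :: "'a set"
  have "good {}" by (simp add: good_def orthonormal_def)
  moreover have "\<forall>B. good B \<longrightarrow> card B < Suc N" using bd by (auto simp: good_def less_Suc_eq_le)
  ultimately obtain B where B: "good B" "\<And>C. good C \<Longrightarrow> card C \<le> card B"
    using ex_has_greatest_nat[of good "{}" card "Suc N"] by (auto simp: less_imp_le)
  have "V \<subseteq> complex_vector.span B"
  proof
    fix x assume x: "x \<in> V"
    obtain C where C: "finite C" "B \<subseteq> C" "orthonormal C"
      "complex_vector.span C = complex_vector.span (B \<union> {x})"
      using orthonormal_extend[of "{x}" B] B(1) by (auto simp: good_def)
    have "C \<subseteq> complex_vector.span (B \<union> {x})" using C(4) complex_vector.span_superset by metis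
    also have "\<dots> \<subseteq> V"
      using x B(1) assms(1) by (intro complex_vector.span_minimal) (auto simp: good_def)
    finally have "card C \<le> card B" using C by (intro B(2)) (simp add: good_def)
    then have "C = B" using C card_seteq by metis
    then show "x \<in> complex_vector.span B"
      using C(4) by (metis UnI2 complex_vector.span_base singletonI)
  qed
  then show ?thesis using B(1) by (auto simp: finite_cdim_def good_def)
qed

text \<open>If \<open>V\<close> held more orthonormal vectors than a basis \<open>C\<close> of
  \<open>W\<close> has, some nonzero vector of \<open>V\<close> would be orthogonal to all
  \<open>cadjoint L c\<close>; its image under \<open>L\<close> would lie in \<open>W\<close> and be
  orthogonal to \<open>C\<close>, hence be 0. Finiteness of \<open>V\<close> is a separate
  conclusion because \<open>dim\<close> is 0 on infinite-dimensional spaces.\<close>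

lemma dim_le_of_injective:
  assumes L: "L \<in> bounded_ops" and V: "complex_vector.subspace V"
    and W: "complex_vector.subspace W" "finite_cdim W"
    and LV: "\<And>x. x \<in> V \<Longrightarrow> L x \<in> W" and inj: "\<And>x. x \<in> V \<Longrightarrow> L x = 0 \<Longrightarrow> x = 0"
  shows "finite_cdim V" and "complex_vector.dim V \<le> complex_vector.dim W"
proof -
  obtain C where C: "finite C" "orthonormal C" "complex_vector.span C = W"
    "complex_vector.dim W = card C"
    using orthonormal_basis_exists[OF W] .
  have le: "card B \<le> card C" if B: "finite B" "orthonormal B" "B \<subseteq> V" for B
  proof (rule ccontr)
    assume "\<not> card B \<le> card C"
    then have "card (cadjoint L ` C) < card B"
      using card_image_le[OF C(1), of "cadjoint L"] by linarith
    then obtain x where x: "x \<in> complex_vector.span B" "x \<noteq> 0"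
      "\<And>h. h \<in> cadjoint L ` C \<Longrightarrow> cinner h x = 0"
      using orthogonal_vector_exists[OF B(1,2), of "cadjoint L ` C"] C(1) by blast
    have xV: "x \<in> V" using x(1) B(3) V by (metis complex_vector.span_minimal subsetD)
    have "L x = 0"
    proof (rule orth_span_eq_0[of _ C])
      show "cinner c (L x) = 0" if "c \<in> C" for c
        using x(3)[of "cadjoint L c"] that by (simp add: cinner_cadjoint[OF L])
    qed (use LV xV C(3) in simp)
    then show False using inj xV x(2) by blast
  qed
  then show fin: "finite_cdim V" by (rule finite_cdim_if_orthonormal_bounded[OF V])
  obtain B where B: "finite B" "orthonormal B" "complex_vector.span B = V"
    "complex_vector.dim V = card B"
    using orthonormal_basis_exists[OF V fin] .
  then show "complex_vector.dim V \<le> complex_vector.dim W"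
    using le[of B] C(4) complex_vector.span_superset by metis
qed

lemma finite_rank_expansion:
  assumes "R \<in> finite_rank_ops"
  obtains B where "finite B" "orthonormal B" "complex_vector.span B = op_ran R"
    "\<And>x. R x = orth_proj B (R x)"
proof -
  have R: "R \<in> bounded_ops" "finite_cdim (op_ran R)"
    using assms by (auto simp: finite_rank_ops_def)
  obtain B where B: "finite B" "orthonormal B" "complex_vector.span B = op_ran R"
    using orthonormal_basis_exists[OF op_ran_subspace[OF R(1)] R(2)] by metis
  have "R x = orth_proj B (R x)" for x
    using orth_proj_eq[OF B(1,2), of "R x"] B(3) by (simp add: op_ran_def)
  then show ?thesis using that B by blast
qed

lemma finite_rank_bounded_ops: "R \<in> finite_rank_ops \<Longrightarrow> R \<in> bounded_ops"
  by (simp add: finite_rank_ops_def)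

text \<open>Taking adjoints in the expansion of \<open>R\<close> along \<open>B\<close> expresses
  \<open>cadjoint R y\<close> through the finitely many vectors \<open>cadjoint R h\<close>.\<close>

lemma finite_rank_cadjoint:
  assumes "R \<in> finite_rank_ops"
  shows "cadjoint R \<in> finite_rank_ops"
proof -
  note R = finite_rank_bounded_ops[OF assms]
  obtain B where B: "finite B" "\<And>x. R x = orth_proj B (R x)"
    using finite_rank_expansion[OF assms] by metis
  have "cadjoint R y \<in> complex_vector.span (cadjoint R ` B)" for y
  proof -
    have "cadjoint R y = (\<Sum>h\<in>B. cinner h y *\<^sub>C cadjoint R h)"
    proof (rule cinner_ext)
      fix x
      have "cinner (cadjoint R y) x = cinner y (orth_proj B (R x))"
        using B(2) by (simp add: cinner_cadjoint[OF R])
      also have "\<dots> = cinner (\<Sum>h\<in>B. cinner h y *\<^sub>C cadjoint R h) x"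
        by (simp add: orth_proj_def cinner_sum_left cinner_sum_right cinner_scaleC_left
            cinner_scaleC_right cinner_cadjoint[OF R] mult.commute flip: cinner_commute)
      finally show "cinner (cadjoint R y) x = cinner (\<Sum>h\<in>B. cinner h y *\<^sub>C cadjoint R h) x" .
    qed
    then show ?thesis
      by (simp add: complex_vector.span_sum complex_vector.span_scale complex_vector.span_base)
  qed
  then have "op_ran (cadjoint R) \<subseteq> complex_vector.span (cadjoint R ` B)" by (auto simp: op_ran_def)
  then show ?thesis
    using B(1) cadjoint_bounded_ops[OF R] by (auto simp: finite_rank_ops_def finite_cdim_def)
qed

lemma finite_cdim_sum:
  assumes "finite_cdim V" "finite_cdim W"
  shows "finite_cdim {x + y |x y. x \<in> V \<and> y \<in> W}"
proof -
  obtain B C where "finite B" "V \<subseteq> complex_vector.span B" "finite C" "W \<subseteq> complex_vector.span C"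
    using assms by (auto simp: finite_cdim_def)
  then show ?thesis
    unfolding finite_cdim_def
    by (intro exI[of _ "B \<union> C"]) (auto simp: complex_vector.span_Un)
qed

lemma finite_rank_add: "S \<in> finite_rank_ops \<Longrightarrow> T \<in> finite_rank_ops \<Longrightarrow> S + T \<in> finite_rank_ops"
proof -
  assume "S \<in> finite_rank_ops" "T \<in> finite_rank_ops"
  moreover have "op_ran (S + T) \<subseteq> {x + y |x y. x \<in> op_ran S \<and> y \<in> op_ran T}"
    unfolding op_ran_def blinfun.add_left[abs_def] by blast
  ultimately show ?thesis
    using finite_cdim_subset finite_cdim_sum bounded_ops_add unfolding finite_rank_ops_def by blast
qed

lemma finite_rank_compose_left:
  assumes "S \<in> bounded_ops" "T \<in> finite_rank_ops"
  shows "S o\<^sub>L T \<in> finite_rank_ops"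
proof -
  obtain B where B: "finite B" "op_ran T \<subseteq> complex_vector.span B"
    using assms(2) by (auto simp: finite_rank_ops_def finite_cdim_def)
  have "S y \<in> complex_vector.span (S ` B)" if "y \<in> complex_vector.span B" for y
    using that
    by (induction rule: complex_vector.span_induct_alt)
      (simp_all add: blinfun.add_right bounded_ops_scaleC[OF assms(1)] complex_vector.span_add
        complex_vector.span_scale complex_vector.span_base complex_vector.span_zero)
  then have "op_ran (S o\<^sub>L T) \<subseteq> complex_vector.span (S ` B)"
    using B(2) by (auto simp: op_ran_def)
  then show ?thesis
    using assms B(1) by (auto simp: finite_rank_ops_def finite_cdim_def bounded_ops_compose)
qed

lemma finite_rank_compose_right:
  assumes "S \<in> finite_rank_ops" "T \<in> bounded_ops"
  shows "S o\<^sub>L T \<in> finite_rank_ops"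
proof -
  have "op_ran (S o\<^sub>L T) \<subseteq> op_ran S" by (auto simp: op_ran_def)
  then show ?thesis
    using assms finite_cdim_subset bounded_ops_compose unfolding finite_rank_ops_def by blast
qed

lemma finite_rank_zero: "0 \<in> finite_rank_ops"
  by (auto simp: finite_rank_ops_def bounded_ops_zero op_ran_def finite_cdim_def
      intro!: exI[of _ "{}"])

lemma finite_rank_scale: "T \<in> finite_rank_ops \<Longrightarrow> c *\<^sub>C T \<in> finite_rank_ops"
  using finite_rank_compose_left[OF bounded_ops_scale[OF bounded_ops_id, of c], of T]
  by (metis (no_types, lifting) blinfun_apply_blinfun_compose blinfun_apply_id_blinfun
      blinfun_apply_scaleC blinfun_eqI)

lemma finite_rank_diff: "S \<in> finite_rank_ops \<Longrightarrow> T \<in> finite_rank_ops \<Longrightarrow> S - T \<in> finite_rank_ops"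
  using finite_rank_add[of S "(-1) *\<^sub>C T"] finite_rank_scale[of T "-1"]
  by (simp add: complex_vector.scale_minus_left)

section \<open>Compact operators\<close>

lemma compact_opsI:
  assumes "T \<in> bounded_ops" "compact K" "\<And>x. norm x \<le> 1 \<Longrightarrow> T x \<in> K"
  shows "T \<in> compact_ops"
proof -
  have "closure (T ` cball 0 1) \<subseteq> K"
    using assms(2,3) by (intro closure_minimal) (auto simp: compact_imp_closed)
  then have "compact (closure (T ` cball 0 1))"
    using assms(2) by (metis compact_Int_closed closed_closure inf.absorb_iff2)
  then show ?thesis using assms(1) by (simp add: compact_ops_def)
qed

lemma compact_ops_bounded_ops: "T \<in> compact_ops \<Longrightarrow> T \<in> bounded_ops"
  by (simp add: compact_ops_def)

lemma compact_ops_in_closure: "norm x \<le> 1 \<Longrightarrow> T x \<in> closure (T ` cball 0 1)"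
  for T :: "'a::chilbert_space \<Rightarrow>\<^sub>L 'a"
  by (intro subsetD[OF closure_subset]) auto

lemma compact_ops_add:
  assumes "S \<in> compact_ops" "T \<in> compact_ops"
  shows "S + T \<in> compact_ops"
proof (rule compact_opsI)
  let ?C = "\<lambda>T :: 'a \<Rightarrow>\<^sub>L 'a. closure (T ` cball 0 1)"
  show "compact {x + y |x y. x \<in> ?C S \<and> y \<in> ?C T}"
    using assms by (intro compact_sums) (auto simp: compact_ops_def)
  show "(S + T) x \<in> {x + y |x y. x \<in> ?C S \<and> y \<in> ?C T}" if "norm x \<le> 1" for x
    using compact_ops_in_closure[OF that] by (auto simp: blinfun.add_left)
qed (use assms compact_ops_bounded_ops bounded_ops_add in blast)

lemma bounded_linear_scaleC_left: "bounded_linear (\<lambda>c. c *\<^sub>C x)"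
  for x :: "'a::complex_normed_vector"
  by (rule bounded_linear_intro[where K = "norm x"])
    (simp_all add: scaleC_add_left norm_scaleC scaleR_conv_of_real
      flip: scaleC_of_real complex_vector.scale_scale)

text \<open>A Minkowski sum of finitely many compact discs. It yields the compactness of finite rank
  operators, whose expansion coefficients on the unit ball are at most
  \<open>norm R\<close>.\<close>

lemma bounded_combinations_in_compact:
  fixes B :: "'a::complex_normed_vector set"
  assumes "finite B"
  shows "\<exists>K. compact K \<and> (\<forall>a. (\<forall>h\<in>B. cmod (a h) \<le> M) \<longrightarrow> (\<Sum>h\<in>B. a h *\<^sub>C h) \<in> K)"
  using assms
proof induction
  case empty
  then show ?case by (intro exI[of _ "{0}"]) simp
next
  case (insert h B)
  then obtain K where K: "compact K"
    "\<And>a. (\<forall>h\<in>B. cmod (a h) \<le> M) \<Longrightarrow> (\<Sum>h\<in>B. a h *\<^sub>C h) \<in> K"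
    by blast
  let ?D = "(\<lambda>c. c *\<^sub>C h) ` cball 0 M"
  have "compact ?D"
    by (intro compact_continuous_image linear_continuous_on bounded_linear_scaleC_left compact_cball)
  then have "compact {x + y |x y. x \<in> ?D \<and> y \<in> K}" using K(1) by (rule compact_sums)
  moreover have "(\<Sum>h\<in>insert h B. a h *\<^sub>C h) \<in> {x + y |x y. x \<in> ?D \<and> y \<in> K}"
    if "\<forall>h\<in>insert h B. cmod (a h) \<le> M" for a
  proof -
    have "a h *\<^sub>C h \<in> ?D" using that by auto
    moreover have "(\<Sum>h\<in>B. a h *\<^sub>C h) \<in> K" using K(2) that by blast
    ultimately show ?thesis unfolding sum.insert[OF insert(1,2)] by blast
  qed
  ultimately show ?case by blast
qed

lemma finite_rank_compact:
  assumes "R \<in> finite_rank_ops"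
  shows "R \<in> compact_ops"
proof -
  obtain B where B: "finite B" "orthonormal B" "\<And>x. R x = orth_proj B (R x)"
    using finite_rank_expansion[OF assms] by metis
  obtain K where K: "compact K"
    "\<And>a. (\<forall>h\<in>B. cmod (a h) \<le> norm R) \<Longrightarrow> (\<Sum>h\<in>B. a h *\<^sub>C h) \<in> K"
    using bounded_combinations_in_compact[OF B(1), of "norm R"] by blast
  show ?thesis
  proof (rule compact_opsI[OF finite_rank_bounded_ops[OF assms] K(1)])
    fix x :: 'a assume x: "norm x \<le> 1"
    have "cmod (cinner h (R x)) \<le> norm R" if "h \<in> B" for h
    proof -
      have "norm (R x) \<le> norm R * norm x" by (rule norm_blinfun)
      also have "\<dots> \<le> norm R" using x by (simp add: mult_left_le)
      finally show ?thesis
        using cauchy_schwarz[of h "R x"] orthonormal_norm[OF B(2) that] by simp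
    qed
    then show "R x \<in> K" using K(2)[of "\<lambda>h. cinner h (R x)"] B(3)[of x] by (simp add: orth_proj_def)
  qed
qed

text \<open>The ranges of \<open>R\<close> and its adjoint, and with them both kernels, lie in one
  finite-dimensional space \<open>M\<close> that \<open>T\<close> maps into itself; there the
  inequality is a count of linear conditions. Using it for the adjoint of \<open>R\<close> as well
  gives equality, that is index 0.\<close>

lemma dim_ker_cadjoint_le:
  assumes R: "R \<in> finite_rank_ops"
  defines "T \<equiv> id_blinfun + R"
  shows "finite_cdim (op_ker T)" and "finite_cdim (op_ker (cadjoint T))"
    and "complex_vector.dim (op_ker (cadjoint T)) \<le> complex_vector.dim (op_ker T)"
proof -
  note Rb = finite_rank_bounded_ops[OF R]
  have Tb: "T \<in> bounded_ops" unfolding T_def by (intro bounded_ops_add bounded_ops_id Rb)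
  have Tad: "cadjoint T = id_blinfun + cadjoint R"
    unfolding T_def by (simp add: cadjoint_add bounded_ops_id Rb cadjoint_id)
  have T_apply: "T x = x + R x" "cadjoint T x = x + cadjoint R x" for x
    by (simp_all add: Tad blinfun.add_left) (simp add: T_def blinfun.add_left)
  obtain S1 S2 where S: "finite S1" "op_ran R \<subseteq> complex_vector.span S1"
      "finite S2" "op_ran (cadjoint R) \<subseteq> complex_vector.span S2"
    using R finite_rank_cadjoint[OF R] by (auto simp: finite_rank_ops_def finite_cdim_def)
  define S where "S = S1 \<union> S2"
  define M where "M = complex_vector.span S"
  have fS: "finite S" using S by (simp add: S_def)
  have ranM: "R x \<in> M" "cadjoint R x \<in> M" for x
    using S(2,4) complex_vector.span_mono[of S1 S] complex_vector.span_mono[of S2 S]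
    by (auto simp: op_ran_def M_def S_def)
  have kerM: "op_ker T \<subseteq> M" "op_ker (cadjoint T) \<subseteq> M"
  proof -
    have "x \<in> M" if "x + F x = 0" "F x \<in> M" for x and F :: "'a \<Rightarrow>\<^sub>L 'a"
      using that complex_vector.span_neg[of "F x" S] by (simp add: M_def add_eq_0_iff2)
    then show "op_ker T \<subseteq> M" "op_ker (cadjoint T) \<subseteq> M"
      using ranM by (auto simp: op_ker_def T_apply)
  qed
  then show fin: "finite_cdim (op_ker T)" "finite_cdim (op_ker (cadjoint T))"
    using finite_cdim_span[OF fS] finite_cdim_subset unfolding M_def by blast+
  obtain B where B: "finite B" "orthonormal B" "complex_vector.span B = op_ker T"
    "complex_vector.dim (op_ker T) = card B"
    using orthonormal_basis_exists[OF op_ker_subspace[OF Tb] fin(1)] .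
  obtain B' where B': "finite B'" "orthonormal B'" "complex_vector.span B' = op_ker (cadjoint T)"
    "complex_vector.dim (op_ker (cadjoint T)) = card B'"
    using orthonormal_basis_exists[OF op_ker_subspace[OF cadjoint_bounded_ops[OF Tb]] fin(2)] .
  obtain C where C: "finite C" "B' \<subseteq> C" "orthonormal C"
      "complex_vector.span C = complex_vector.span (B' \<union> S)"
    using orthonormal_extend[OF fS B'(1,2)] by blast
  have B'M: "B' \<subseteq> M" using B'(3) kerM(2) complex_vector.span_superset by blast
  then have CM: "complex_vector.span C = M"
    unfolding C(4) M_def using complex_vector.span_superset[of S]
    by (intro antisym complex_vector.span_minimal complex_vector.span_mono) auto
  show "complex_vector.dim (op_ker (cadjoint T)) \<le> complex_vector.dim (op_ker T)"
  proof (rule ccontr)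
    assume "\<not> ?thesis"
    then have less: "card B < card B'" using B(4) B'(4) by simp
    \<comment> \<open>A dimension count gives a nonzero vector that is orthogonal to the kernel of \<open>T\<close> and lies in it.\<close>
    define H where "H = B \<union> cadjoint T ` (C - B')"
    have "card H \<le> card B + card (cadjoint T ` (C - B'))" unfolding H_def by (rule card_Un_le)
    also have "\<dots> \<le> card B + card (C - B')" using C(1) by (simp add: card_image_le)
    also have "\<dots> < card C"
      using less card_Diff_subset[OF B'(1) C(2)] card_mono[OF C(1,2)] by linarith
    finally have "card H < card C" .
    moreover have "finite H" using B(1) C(1) by (simp add: H_def)
    ultimately obtain x where x: "x \<in> complex_vector.span C" "x \<noteq> 0"
      "\<And>h. h \<in> H \<Longrightarrow> cinner h x = 0"
      using orthogonal_vector_exists[OF C(1,3)] by blast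
    have "T x = 0"
    proof (rule orth_span_eq_0[of _ C])
      show "T x \<in> complex_vector.span C"
        using x(1) ranM(1)[of x] unfolding T_apply CM[symmetric] by (rule complex_vector.span_add)
      \<comment> \<open>For \<open>c\<close> in \<open>B'\<close> this holds whatever
        \<open>x\<close> is, so only \<open>C - B'\<close> contributes conditions to
        \<open>H\<close>. This saving is what makes \<open>card H\<close> smaller than
        \<open>card C\<close>.\<close>
      show "cinner c (T x) = 0" if "c \<in> C" for c
      proof (cases "c \<in> B'")
        case True
        then have "cadjoint T c = 0"
          using B'(3) complex_vector.span_base by (fastforce simp: op_ker_def)
        then show ?thesis by (simp flip: cinner_cadjoint[OF Tb])
      next
        case False
        then show ?thesis using x(3)[of "cadjoint T c"] that
          by (simp add: H_def flip: cinner_cadjoint[OF Tb])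
      qed
    qed
    then have "x = 0"
      by (intro orth_span_eq_0[of x B]) (use B(3) x(3) in \<open>auto simp: op_ker_def H_def\<close>)
    then show False using x(2) by simp
  qed
qed

section \<open>Invertible operators, the index and the Fredholm property\<close>

lemma is_inverse_adjoint_apply:
  assumes "T \<in> bounded_ops" "is_inverse T S"
  shows "cadjoint S (cadjoint T x) = x" "cadjoint T (cadjoint S x) = x"
proof -
  have S: "S \<in> bounded_ops" "S o\<^sub>L T = id_blinfun" "T o\<^sub>L S = id_blinfun"
    using assms(2) by (auto simp: is_inverse_def)
  show "cadjoint S (cadjoint T x) = x"
    using cadjoint_compose[OF assms(1) S(1)] S(3) cadjoint_id
    by (metis blinfun_apply_blinfun_compose blinfun_apply_id_blinfun)
  show "cadjoint T (cadjoint S x) = x"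
    using cadjoint_compose[OF S(1) assms(1)] S(2) cadjoint_id
    by (metis blinfun_apply_blinfun_compose blinfun_apply_id_blinfun)
qed

lemma is_inverse_apply:
  assumes "is_inverse T S"
  shows "S (T x) = x" "T (S x) = x"
  using assms by (metis is_inverse_def blinfun_apply_blinfun_compose blinfun_apply_id_blinfun)+

text \<open>The invertible \<open>V\<close> leaves the kernel of \<open>id_blinfun + R\<close>
  unchanged and moves the adjoint kernel injectively: \<open>cadjoint V\<close> maps the new one
  into the old one, and \<open>cadjoint W\<close> maps back.\<close>

lemma op_index_invertible_compose:
  assumes V: "V \<in> bounded_ops" "is_inverse V W" and R: "R \<in> finite_rank_ops"
  shows "op_index (V o\<^sub>L (id_blinfun + R)) = 0"
proof -
  define T where "T = id_blinfun + R"
  have Rad: "cadjoint R \<in> finite_rank_ops" by (rule finite_rank_cadjoint[OF R])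
  have Tb: "T \<in> bounded_ops"
    unfolding T_def by (intro bounded_ops_add bounded_ops_id finite_rank_bounded_ops R)
  have Tad: "cadjoint T = id_blinfun + cadjoint R"
    unfolding T_def by (simp add: cadjoint_add bounded_ops_id finite_rank_bounded_ops R cadjoint_id)
  have Wb: "W \<in> bounded_ops" using V(2) by (simp add: is_inverse_def)
  have VTb: "V o\<^sub>L T \<in> bounded_ops" by (intro bounded_ops_compose V Tb)
  have "complex_vector.dim (op_ker (cadjoint T)) = complex_vector.dim (op_ker T)"
    using dim_ker_cadjoint_le[OF R] dim_ker_cadjoint_le[OF Rad] cadjoint_cadjoint[OF Tb]
    by (simp flip: Tad T_def)
  moreover have "op_ker (V o\<^sub>L T) = op_ker T"
    using is_inverse_apply(1)[OF V(2)] by (auto simp: op_ker_def) (metis blinfun.zero_right)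
  moreover have ad: "cadjoint (V o\<^sub>L T) = cadjoint T o\<^sub>L cadjoint V"
    by (intro cadjoint_compose V Tb)
  have fin: "finite_cdim (op_ker (cadjoint T))" unfolding T_def by (rule dim_ker_cadjoint_le[OF R])
  have sub: "complex_vector.subspace (op_ker (cadjoint T))"
    "complex_vector.subspace (op_ker (cadjoint (V o\<^sub>L T)))"
    by (intro op_ker_subspace cadjoint_bounded_ops Tb VTb)+
  note inv = is_inverse_adjoint_apply[OF V]
  have le: "finite_cdim (op_ker (cadjoint (V o\<^sub>L T)))"
    "complex_vector.dim (op_ker (cadjoint (V o\<^sub>L T))) \<le> complex_vector.dim (op_ker (cadjoint T))"
    by (rule dim_le_of_injective[OF cadjoint_bounded_ops[OF V(1)] sub(2,1) fin];
        use inv(1) in \<open>simp add: ad op_ker_def; metis blinfun.zero_right\<close>)+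
  have "complex_vector.dim (op_ker (cadjoint T)) \<le> complex_vector.dim (op_ker (cadjoint (V o\<^sub>L T)))"
    by (rule dim_le_of_injective[OF cadjoint_bounded_ops[OF Wb] sub le(1)];
        use inv(2) in \<open>simp add: ad op_ker_def; metis blinfun.zero_right\<close>)
  ultimately show ?thesis using le(2) by (simp add: op_index_def flip: T_def)
qed

lemma op_ker_invertible:
  assumes "is_inverse T S"
  shows "op_ker T = {0}"
  using is_inverse_apply(1)[OF assms] by (auto simp: op_ker_def) (metis blinfun.zero_right)

lemma op_ran_invertible:
  assumes "is_inverse T S"
  shows "op_ran T = UNIV"
  using is_inverse_apply(2)[OF assms] by (auto simp: op_ran_def) (metis rangeI)

lemma op_ker_cadjoint_invertible:
  assumes "T \<in> bounded_ops" "is_inverse T S"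
  shows "op_ker (cadjoint T) = {0}"
  using is_inverse_adjoint_apply(1)[OF assms] by (auto simp: op_ker_def) (metis blinfun.zero_right)

lemma finite_cdim_zero: "finite_cdim {0}"
  by (auto simp: finite_cdim_def intro!: exI[of _ "{}"])

lemma invertible_fredholm:
  assumes "T \<in> bounded_ops" "is_inverse T S"
  shows "T \<in> fredholm_ops" "op_index T = 0"
  by (simp_all add: fredholm_ops_def op_index_def op_ker_invertible[OF assms(2)]
      op_ran_invertible[OF assms(2)] op_ker_cadjoint_invertible[OF assms] assms(1) finite_cdim_zero)

text \<open>Precomposing with the bijection \<open>F\<close> keeps the range, hence also the adjoint
  kernel as its orthogonal complement; \<open>F\<close> carries the kernel injectively into that of
  \<open>T\<close>.\<close>

lemma fredholm_compose_invertible: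
  assumes "T \<in> fredholm_ops" "F \<in> bounded_ops" "is_inverse F G"
  shows "T o\<^sub>L F \<in> fredholm_ops"
proof -
  have T: "T \<in> bounded_ops" "finite_cdim (op_ker T)" "closed (op_ran T)"
      "finite_cdim (op_ker (cadjoint T))"
    using assms(1) by (auto simp: fredholm_ops_def)
  have TF: "T o\<^sub>L F \<in> bounded_ops" by (intro bounded_ops_compose T assms)
  have "finite_cdim (op_ker (T o\<^sub>L F))"
    by (rule dim_le_of_injective(1)[OF assms(2) op_ker_subspace[OF TF] op_ker_subspace[OF T(1)] T(2)];
        use is_inverse_apply(1)[OF assms(3)] in \<open>simp add: op_ker_def; metis blinfun.zero_right\<close>)
  moreover have ran: "range (T o\<^sub>L F) = range T"
    using op_ran_invertible[OF assms(3)] by (simp add: op_ran_def flip: image_image)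
  then have "closed (op_ran (T o\<^sub>L F))" using T(3) by (simp add: op_ran_def)
  moreover have "op_ker (cadjoint (T o\<^sub>L F)) = op_ker (cadjoint T)"
  proof -
    have "(\<forall>y. cinner x ((T o\<^sub>L F) y) = 0) \<longleftrightarrow> (\<forall>y. cinner x (T y) = 0)" for x
    proof -
      have "(\<forall>y. cinner x ((T o\<^sub>L F) y) = 0) \<longleftrightarrow> (\<forall>v\<in>range (T o\<^sub>L F). cinner x v = 0)" by simp
      also have "\<dots> \<longleftrightarrow> (\<forall>y. cinner x (T y) = 0)" unfolding ran by simp
      finally show ?thesis .
    qed
    then show ?thesis unfolding op_ker_cadjoint[OF TF] op_ker_cadjoint[OF T(1)] by simp
  qed
  ultimately show ?thesis using T(4) TF by (simp add: fredholm_ops_def)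
qed

section \<open>Schatten classes and finite rank perturbations\<close>

text \<open>For \<open>s > 0\<close> these are the right singular vectors of \<open>T\<close> for
  the singular value \<open>s\<close>, together with 0.\<close>

definition sv_space :: "('a::chilbert_space \<Rightarrow>\<^sub>L 'a) \<Rightarrow> real \<Rightarrow> 'a set"
  where "sv_space T s = op_ker ((cadjoint T o\<^sub>L T) - complex_of_real (s\<^sup>2) *\<^sub>C id_blinfun)"

definition sv_mult :: "('a::chilbert_space \<Rightarrow>\<^sub>L 'a) \<Rightarrow> real \<Rightarrow> nat"
  where "sv_mult T s = geo_mult (complex_of_real (s\<^sup>2)) (cadjoint T o\<^sub>L T)"

lemma sv_mult_eq_dim: "sv_mult T s = complex_vector.dim (sv_space T s)"
  unfolding sv_mult_def sv_space_def geo_mult_def ..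

lemma sv_space_iff: "x \<in> sv_space T s \<longleftrightarrow> cadjoint T (T x) = complex_of_real (s\<^sup>2) *\<^sub>C x"
  by (simp add: sv_space_def op_ker_def blinfun.diff_left blinfun_apply_scaleC)

lemma sv_space_subspace: "T \<in> bounded_ops \<Longrightarrow> complex_vector.subspace (sv_space T s)"
  unfolding sv_space_def
  by (intro op_ker_subspace bounded_ops_diff bounded_ops_compose bounded_ops_scale bounded_ops_id
      cadjoint_bounded_ops)

lemma cinner_sv_space:
  assumes "T \<in> bounded_ops" "y \<in> sv_space T s"
  shows "cinner (T x) (T y) = complex_of_real (s\<^sup>2) * cinner x y"
  using cinner_cadjoint_right[OF assms(1), of x "T y"] assms(2)
  by (simp add: sv_space_iff cinner_scaleC_right)

lemma norm_sv_space:
  assumes "T \<in> bounded_ops" "x \<in> sv_space T s"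
  shows "(norm (T x))\<^sup>2 = s\<^sup>2 * (norm x)\<^sup>2"
  using cinner_sv_space[OF assms, of x]
  by (simp add: norm_sq_eq_cinner flip: of_real_power)

lemma sv_space_orthogonal:
  assumes T: "T \<in> bounded_ops" and "x \<in> sv_space T s" "y \<in> sv_space T s'"
    and "s > 0" "s' > 0" "s \<noteq> s'"
  shows "cinner x y = 0"
proof -
  have "cinner (T y) (T x) = complex_of_real (s\<^sup>2) * cinner y x"
    by (rule cinner_sv_space[OF T assms(2)])
  then have "complex_of_real (s\<^sup>2) * cinner x y = cinner (T x) (T y)"
    by (metis cinner_commute complex_cnj_complex_of_real complex_cnj_mult)
  also have "\<dots> = complex_of_real (s'\<^sup>2) * cinner x y"
    by (rule cinner_sv_space[OF T assms(3)])
  finally have "complex_of_real (s\<^sup>2) * cinner x y = complex_of_real (s'\<^sup>2) * cinner x y" .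
  moreover have "s\<^sup>2 \<noteq> s'\<^sup>2" using assms(4-6) by (simp add: power2_eq_iff)
  ultimately show ?thesis by (metis mult_right_cancel of_real_eq_iff)
qed

text \<open>The images of the vectors of \<open>U\<close> are \<open>t\<close>-separated in a totally bounded set.\<close>

lemma sv_card_bound:
  fixes T :: "'a::chilbert_space \<Rightarrow>\<^sub>L 'a"
  assumes T: "T \<in> compact_ops" and t: "t > 0"
  obtains N where "\<And>U. finite U \<Longrightarrow> orthonormal U \<Longrightarrow> U \<subseteq> (\<Union>s\<in>{t..}. sv_space T s) \<Longrightarrow> card U \<le> N"
proof -
  note Tb = compact_ops_bounded_ops[OF T]
  have "compact (closure (T ` cball 0 1))" using T by (simp add: compact_ops_def)
  then obtain K where K: "finite K" "closure (T ` cball 0 1) \<subseteq> (\<Union>x\<in>K. ball x (t / 2))"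
    unfolding compact_eq_totally_bounded using t half_gt_zero by meson
  have "card U \<le> card K"
    if U: "finite U" "orthonormal U" "U \<subseteq> (\<Union>s\<in>{t..}. sv_space T s)" for U
  proof -
    have "\<exists>x\<in>K. T u \<in> ball x (t / 2)" if "u \<in> U" for u
      using compact_ops_in_closure[of u T] orthonormal_norm[OF U(2) that] K(2) by force
    then obtain f where f: "\<And>u. u \<in> U \<Longrightarrow> f u \<in> K" "\<And>u. u \<in> U \<Longrightarrow> T u \<in> ball (f u) (t / 2)"
      by metis
    have "u = v" if uv: "u \<in> U" "v \<in> U" "f u = f v" for u v
    proof (rule ccontr)
      assume "u \<noteq> v"
      then have "cinner u v = 0" using U(2) uv by (simp add: orthonormal_def)
      obtain s s' where s: "s \<ge> t" "u \<in> sv_space T s" "s' \<ge> t" "v \<in> sv_space T s'"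
        using subsetD[OF U(3) uv(1)] subsetD[OF U(3) uv(2)] by auto
      have "cinner (T u) (T v) = 0"
        using cinner_sv_space[OF Tb s(4), of u] \<open>cinner u v = 0\<close> by simp
      moreover have "(norm (T u))\<^sup>2 \<ge> t\<^sup>2" "(norm (T v))\<^sup>2 \<ge> t\<^sup>2"
        using norm_sv_space[OF Tb s(2)] norm_sv_space[OF Tb s(4)] s t orthonormal_norm[OF U(2)] uv
        by (simp_all add: power_mono)
      ultimately have "(norm (T u - T v))\<^sup>2 \<ge> t\<^sup>2"
        by (simp add: norm_sq_diff add_increasing2)
      then have "t \<le> dist (T u) (T v)"
        unfolding dist_norm by (rule power2_le_imp_le) simp
      moreover have "dist (T u) (T v) < t / 2 + t / 2"
        using f(2)[OF uv(1)] f(2)[OF uv(2)] dist_triangle3[of "T u" "T v" "f u"]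
        unfolding uv(3) mem_ball by linarith
      ultimately show False by simp
    qed
    then have "inj_on f U" by (rule inj_onI)
    then show ?thesis using f(1) K(1) by (meson card_inj_on_le image_subsetI)
  qed
  then show ?thesis using that by blast
qed

lemma sv_space_finite_cdim:
  assumes "T \<in> compact_ops" "s > 0"
  shows "finite_cdim (sv_space T s)"
proof -
  obtain N where N: "\<And>U. finite U \<Longrightarrow> orthonormal U \<Longrightarrow> U \<subseteq> (\<Union>s\<in>{s..}. sv_space T s) \<Longrightarrow> card U \<le> N"
    using sv_card_bound[OF assms] by blast
  show ?thesis
    by (rule finite_cdim_if_orthonormal_bounded[of _ N])
      (use N sv_space_subspace[OF compact_ops_bounded_ops[OF assms(1)]] in \<open>fastforce+\<close>)
qed

definition sv_basis_family :: "('a::chilbert_space \<Rightarrow>\<^sub>L 'a) \<Rightarrow> (real \<Rightarrow> 'a set) \<Rightarrow> bool"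
  where "sv_basis_family T E \<longleftrightarrow> (\<forall>s>0. finite (E s) \<and> orthonormal (E s)
    \<and> complex_vector.span (E s) = sv_space T s \<and> card (E s) = sv_mult T s)"

lemma sv_bases:
  assumes "T \<in> compact_ops"
  obtains E where "sv_basis_family T E"
proof -
  have "\<exists>E. s > 0 \<longrightarrow> finite E \<and> orthonormal E \<and> complex_vector.span E = sv_space T s
      \<and> card E = sv_mult T s" for s
    using orthonormal_basis_exists[OF sv_space_subspace[OF compact_ops_bounded_ops[OF assms]]
        sv_space_finite_cdim[OF assms], of s] by (metis sv_mult_eq_dim)
  then show ?thesis using that unfolding sv_basis_family_def by metis
qed

lemma sv_bases_union:
  assumes T: "T \<in> compact_ops"
    and E_family: "sv_basis_family T E"
    and F: "finite F" "F \<subseteq> {0<..}"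
  shows "orthonormal (\<Union>s\<in>F. E s)" "finite (\<Union>s\<in>F. E s)"
    "card (\<Union>s\<in>F. E s) = (\<Sum>s\<in>F. sv_mult T s)" "(\<Union>s\<in>F. E s) \<subseteq> (\<Union>s\<in>F. sv_space T s)"
proof -
  have E: "finite (E s)" "orthonormal (E s)" "complex_vector.span (E s) = sv_space T s"
    "card (E s) = sv_mult T s" if "s > 0" for s
    using E_family that by (auto simp: sv_basis_family_def)
  have sv: "u \<in> sv_space T s" if "s \<in> F" "u \<in> E s" for s u
    using that F E(3)[of s] complex_vector.span_base[of u "E s"] by auto
  then show "(\<Union>s\<in>F. E s) \<subseteq> (\<Union>s\<in>F. sv_space T s)" by blast
  have orth: "cinner u v = 0" if "s \<in> F" "s' \<in> F" "s \<noteq> s'" "u \<in> E s" "v \<in> E s'" for s s' u v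
    using sv_space_orthogonal[OF compact_ops_bounded_ops[OF T] sv sv, of s u s' v] that F by auto
  have unit: "cinner u u = 1" if "s \<in> F" "u \<in> E s" for s u
    using E(2)[of s] that F by (auto simp: orthonormal_def)
  show "orthonormal (\<Union>s\<in>F. E s)"
    unfolding orthonormal_def
  proof (intro ballI)
    fix u v assume "u \<in> (\<Union>s\<in>F. E s)" "v \<in> (\<Union>s\<in>F. E s)"
    then obtain s s' where s: "s \<in> F" "u \<in> E s" "s' \<in> F" "v \<in> E s'" by blast
    show "cinner u v = (if u = v then 1 else 0)"
    proof (cases "s = s'")
      case True
      then show ?thesis using E(2)[of s] s F(2) by (auto simp: orthonormal_def)
    next
      case False
      then have "cinner u v = 0" using orth s by blast
      then show ?thesis using unit[OF s(1,2)] by auto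
    qed
  qed
  show "finite (\<Union>s\<in>F. E s)" using F E(1) by auto
  have "E s \<inter> E s' = {}" if "s \<in> F" "s' \<in> F" "s \<noteq> s'" for s s'
    using orth[OF that] unit[OF that(1)] by fastforce
  then have "card (\<Union>s\<in>F. E s) = (\<Sum>s\<in>F. card (E s))"
    using F E(1) by (intro card_UN_disjoint) auto
  also have "\<dots> = (\<Sum>s\<in>F. sv_mult T s)" using F E(4) by (intro sum.cong) auto
  finally show "card (\<Union>s\<in>F. E s) = (\<Sum>s\<in>F. sv_mult T s)" .
qed

text \<open>Basis vectors taken from different singular spaces form one orthonormal set, and each
  singular value contributes at least one of them, so the bound on such sets also bounds the number
  of values.\<close>

lemma finite_singular_values:
  assumes T: "T \<in> compact_ops" and t: "t > 0"
  shows "finite {s. t \<le> s \<and> sv_mult T s \<noteq> 0}"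
proof -
  obtain N where N: "\<And>U. finite U \<Longrightarrow> orthonormal U \<Longrightarrow> U \<subseteq> (\<Union>s\<in>{t..}. sv_space T s) \<Longrightarrow> card U \<le> N"
    using sv_card_bound[OF T t] by blast
  obtain E where E: "sv_basis_family T E"
    using sv_bases[OF T] by blast
  have "card F \<le> N" if F: "F \<subseteq> {s. t \<le> s \<and> sv_mult T s \<noteq> 0}" "finite F" for F
  proof -
    have F0: "F \<subseteq> {0<..}" using F(1) t by auto
    note U = sv_bases_union[OF T E F(2) F0]
    have "card F = (\<Sum>s\<in>F. 1)" by simp
    also have "\<dots> \<le> (\<Sum>s\<in>F. sv_mult T s)" using F(1) by (intro sum_mono) (auto simp: Suc_le_eq)
    also have "\<dots> \<le> N"
      unfolding U(3)[symmetric] using U F(1) by (intro N) auto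
    finally show ?thesis .
  qed
  then show ?thesis
    using finite_if_finite_subsets_card_bdd[of "{s. t \<le> s \<and> sv_mult T s \<noteq> 0}" N] by blast
qed

text \<open>Different singular spaces are orthogonal, and so are their images under
  \<open>T\<close>; by Pythagoras the squared bounds on the single spaces add up.\<close>

lemma norm_ge_on_sv_span:
  assumes T: "T \<in> bounded_ops" and t: "t > 0"
    and "finite F" "F \<subseteq> {t..}" "x \<in> complex_vector.span (\<Union>s\<in>F. sv_space T s)"
  shows "t * norm x \<le> norm (T x)"
proof -
  have "t\<^sup>2 * (norm x)\<^sup>2 \<le> (norm (T x))\<^sup>2"
    using assms(3-5)
  proof (induction F arbitrary: x)
    case empty
    then show ?case by simp
  next
    case (insert s F)
    have sp: "complex_vector.span (sv_space T s) = sv_space T s"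
      using sv_space_subspace[OF T] by (simp add: complex_vector.span_eq_iff)
    then have "x \<in> {e + y |e y. e \<in> sv_space T s \<and> y \<in> complex_vector.span (\<Union>s\<in>F. sv_space T s)}"
      using insert.prems(2) unfolding image_insert Union_insert complex_vector.span_Un sp by blast
    then obtain e y where x: "x = e + y" "e \<in> sv_space T s"
      "y \<in> complex_vector.span (\<Union>s\<in>F. sv_space T s)"
      by blast
    have s: "t \<le> s" using insert.prems by simp
    have ey: "cinner y e = 0"
    proof -
      have "cinner e y = 0"
      proof (rule cinner_orth_span[OF _ x(3)])
        fix b assume "b \<in> (\<Union>s\<in>F. sv_space T s)"
        then obtain s' where "s' \<in> F" "b \<in> sv_space T s'" by blast
        then show "cinner e b = 0"
          using sv_space_orthogonal[OF T x(2), of b s'] insert.hyps insert.prems(1) t s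
          by fastforce
      qed
      then show ?thesis using cinner_eq_0_commute by blast
    qed
    have "cinner (T y) (T e) = 0" using cinner_sv_space[OF T x(2), of y] ey by simp
    then have "(norm (T x))\<^sup>2 = (norm (T y))\<^sup>2 + (norm (T e))\<^sup>2"
      using norm_sq_add[of "T y" "T e"] by (simp add: x(1) blinfun.add_right add.commute)
    moreover have "(norm x)\<^sup>2 = (norm y)\<^sup>2 + (norm e)\<^sup>2"
      using norm_sq_add[of y e] ey by (simp add: x(1) add.commute)
    moreover have "t\<^sup>2 * (norm y)\<^sup>2 \<le> (norm (T y))\<^sup>2"
      using insert.IH[OF _ x(3)] insert.prems(1) by simp
    moreover have "t\<^sup>2 * (norm e)\<^sup>2 \<le> (norm (T e))\<^sup>2"
      using norm_sv_space[OF T x(2)] s t by (simp add: mult_right_mono power_mono)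
    ultimately show ?case by (simp add: distrib_left)
  qed
  then show ?thesis
    by - (rule power2_le_imp_le, simp_all add: power_mult_distrib)
qed

text \<open>Otherwise, by compactness, the norm of \<open>T\<close> on the complement of its singular vectors with singular
  values at least \<open>t\<close> would be attained at such a singular vector.\<close>

lemma norm_less_on_sv_complement:
  fixes T :: "'a::chilbert_space \<Rightarrow>\<^sub>L 'a"
  assumes T: "T \<in> compact_ops" and t: "t > 0" and x0: "x0 \<noteq> 0"
    and orth: "\<And>s e. t \<le> s \<Longrightarrow> e \<in> sv_space T s \<Longrightarrow> cinner e x0 = 0"
  shows "norm (T x0) < t * norm x0"
proof (rule ccontr)
  assume "\<not> norm (T x0) < t * norm x0"
  then have ge: "t * norm x0 \<le> norm (T x0)" by simp
  note Tb = compact_ops_bounded_ops[OF T]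
  define X where "X = {x. \<forall>s\<ge>t. \<forall>e\<in>sv_space T s. cinner e x = 0}"
  have X_scale: "c *\<^sub>C x \<in> X" if "x \<in> X" for c x
    using that by (simp add: X_def cinner_scaleC_right)
  have X_inv: "cadjoint T (T x) \<in> X" if "x \<in> X" for x
  proof -
    have "cinner e (cadjoint T (T x)) = 0" if "s \<ge> t" "e \<in> sv_space T s" for e s
    proof -
      have "cinner e (cadjoint T (T x)) = cinner (cadjoint T (T e)) x"
        by (simp add: cinner_cadjoint_right[OF Tb] cinner_cadjoint[OF Tb])
      then show ?thesis using that \<open>x \<in> X\<close> by (simp add: sv_space_iff cinner_scaleC_left X_def)
    qed
    then show ?thesis by (simp add: X_def)
  qed
  define S where "S = (\<lambda>x. norm (T x)) ` {x \<in> X. norm x = 1}"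
  define \<sigma> where "\<sigma> = Sup S"
  have bdd: "bdd_above S"
    unfolding S_def using norm_blinfun[of T] by (intro bdd_aboveI[of _ "norm T"]) (auto, metis mult.right_neutral)
  have unit: "norm (complex_of_real (inverse (norm x)) *\<^sub>C x) = 1" if "x \<noteq> 0" for x :: 'a
    using that by (simp add: norm_scaleC norm_inverse del: of_real_inverse)
  have normT: "norm (T (complex_of_real (inverse (norm x)) *\<^sub>C x)) = norm (T x) / norm x" for x
    by (simp add: bounded_ops_scaleC[OF Tb] norm_scaleC norm_inverse divide_inverse del: of_real_inverse)
  have le_sigma: "norm (T x) \<le> \<sigma> * norm x" if "x \<in> X" for x
  proof (cases "x = 0")
    case False
    have "norm (T (complex_of_real (inverse (norm x)) *\<^sub>C x)) \<in> S"
      unfolding S_def using X_scale[OF that] unit[OF False] by blast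
    then have "norm (T x) / norm x \<le> \<sigma>" unfolding \<sigma>_def normT by (rule cSup_upper[OF _ bdd])
    then show ?thesis using False by (simp add: field_simps)
  qed simp
  have "x0 \<in> X" using orth by (simp add: X_def)
  then have S_ne: "norm (T (complex_of_real (inverse (norm x0)) *\<^sub>C x0)) \<in> S"
    unfolding S_def using X_scale unit[OF x0] by blast
  have "t \<le> norm (T x0) / norm x0" using ge x0 by (simp add: field_simps)
  also have "\<dots> \<le> \<sigma>" using S_ne unfolding \<sigma>_def normT by (rule cSup_upper[OF _ bdd])
  finally have t_le: "t \<le> \<sigma>" .
  then have \<sigma>0: "\<sigma> > 0" using t by simp
  have "\<exists>x. x \<in> X \<and> norm x = 1 \<and> \<sigma> - inverse (real (Suc n)) < norm (T x)" for n
  proof -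
    have "\<exists>y\<in>S. \<sigma> - inverse (real (Suc n)) < y"
      unfolding \<sigma>_def using S_ne bdd by (subst less_cSup_iff[symmetric]) auto
    then show ?thesis by (auto simp: S_def)
  qed
  then obtain x where x: "\<And>n. x n \<in> X" "\<And>n. norm (x n) = 1"
    "\<And>n. \<sigma> - inverse (real (Suc n)) < norm (T (x n))" by metis
  have "compact (closure (T ` cball 0 1))" using T by (simp add: compact_ops_def)
  moreover have "\<forall>n. T (x n) \<in> closure (T ` cball 0 1)"
    using x(2) by (simp add: compact_ops_in_closure)
  ultimately obtain y r where r: "strict_mono r" and y: "((\<lambda>n. T (x n)) \<circ> r) \<longlonglongrightarrow> y"
    unfolding compact_def by metis
  have norm_lim: "(\<lambda>n. norm (T (x n))) \<longlonglongrightarrow> \<sigma>"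
  proof (rule tendsto_sandwich)
    show "(\<lambda>n. \<sigma> - inverse (real (Suc n))) \<longlonglongrightarrow> \<sigma>"
      using tendsto_diff[OF tendsto_const LIMSEQ_inverse_real_of_nat, of \<sigma>] by simp
    show "\<forall>\<^sub>F n in sequentially. norm (T (x n)) \<le> \<sigma>"
      using le_sigma[OF x(1)] x(2) by (simp add: always_eventually)
    show "\<forall>\<^sub>F n in sequentially. \<sigma> - inverse (real (Suc n)) \<le> norm (T (x n))"
      using x(3) by (simp add: always_eventually less_imp_le)
  qed simp
  \<comment> \<open>A unit vector on which \<open>norm (T x)\<close> is close to
    \<open>\<sigma>\<close> is thus an approximate eigenvector. The key estimate
    \<open>norm w \<le> \<sigma> * norm (T x)\<close> relies on the invariance of \<open>X\<close>,
    which lets the bound by \<open>\<sigma>\<close> be applied to \<open>w\<close> itself.\<close>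
  have defect: "(norm (cadjoint T (T x) - complex_of_real (\<sigma>\<^sup>2) *\<^sub>C x))\<^sup>2
      \<le> \<sigma>\<^sup>2 * (\<sigma>\<^sup>2 - (norm (T x))\<^sup>2)" if "x \<in> X" "norm x = 1" for x
  proof -
    define w where "w = cadjoint T (T x)"
    have w2: "cinner w w = cinner (T x) (T w)" by (simp add: w_def cinner_cadjoint[OF Tb])
    have "(norm w)\<^sup>2 \<le> norm (T x) * norm (T w)"
      using cauchy_schwarz[of "T x" "T w"] complex_Re_le_cmod[of "cinner (T x) (T w)"]
      by (simp add: norm_sq_eq_cinner w2)
    also have "\<dots> \<le> norm (T x) * (\<sigma> * norm w)"
      using le_sigma[OF X_inv[OF that(1)]] by (intro mult_left_mono) (simp_all add: w_def)
    finally have "norm w \<le> \<sigma> * norm (T x)"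
      using \<sigma>0 by (cases "norm w = 0") (simp_all add: power2_eq_square mult.commute)
    then have "(norm w)\<^sup>2 \<le> \<sigma>\<^sup>2 * (norm (T x))\<^sup>2"
      by (metis norm_ge_zero power_mono power_mult_distrib)
    moreover have "Re (cinner w (complex_of_real (\<sigma>\<^sup>2) *\<^sub>C x)) = \<sigma>\<^sup>2 * (norm (T x))\<^sup>2"
      unfolding w_def cinner_scaleC_right cinner_cadjoint[OF Tb] cinner_self
      by (simp flip: of_real_power of_real_mult)
    moreover have "(norm (complex_of_real (\<sigma>\<^sup>2) *\<^sub>C x))\<^sup>2 = \<sigma>\<^sup>2 * \<sigma>\<^sup>2"
      unfolding norm_scaleC norm_of_real that(2) by (simp add: power2_eq_square)
    ultimately show ?thesis
      unfolding w_def[symmetric] norm_sq_diff by (simp add: algebra_simps)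
  qed
  define d where "d n = cadjoint T (T (x (r n))) - complex_of_real (\<sigma>\<^sup>2) *\<^sub>C x (r n)" for n
  have "(\<lambda>n. (norm (d n))\<^sup>2) \<longlonglongrightarrow> 0"
  proof (rule tendsto_sandwich[OF _ _ tendsto_const])
    have "(\<lambda>n. \<sigma>\<^sup>2 * (\<sigma>\<^sup>2 - (norm (T (x (r n))))\<^sup>2)) \<longlonglongrightarrow> \<sigma>\<^sup>2 * (\<sigma>\<^sup>2 - \<sigma>\<^sup>2)"
      using LIMSEQ_subseq_LIMSEQ[OF norm_lim r] by (intro tendsto_intros) (simp add: o_def)
    then show "(\<lambda>n. \<sigma>\<^sup>2 * (\<sigma>\<^sup>2 - (norm (T (x (r n))))\<^sup>2)) \<longlonglongrightarrow> 0" by simp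
    show "\<forall>\<^sub>F n in sequentially. (norm (d n))\<^sup>2 \<le> \<sigma>\<^sup>2 * (\<sigma>\<^sup>2 - (norm (T (x (r n))))\<^sup>2)"
      unfolding d_def using defect[OF x(1,2)] by (simp add: always_eventually)
  qed simp_all
  then have "(\<lambda>n. sqrt ((norm (d n))\<^sup>2)) \<longlonglongrightarrow> sqrt 0" by (rule tendsto_real_sqrt)
  then have d_lim: "d \<longlonglongrightarrow> 0" by (simp add: tendsto_norm_zero_iff)
  \<comment> \<open>Solving the definition of \<open>d\<close> for \<open>x (r n)\<close> shows that
    the maximizing sequence itself converges along \<open>r\<close>, not merely its image under
    \<open>T\<close>.\<close>
  define v where "v = complex_of_real (inverse (\<sigma>\<^sup>2)) *\<^sub>C cadjoint T y"
  have "x (r n) = complex_of_real (inverse (\<sigma>\<^sup>2)) *\<^sub>C (cadjoint T (T (x (r n))) - d n)" for n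
    using \<sigma>0 by (simp add: d_def)
  moreover have "(\<lambda>n. complex_of_real (inverse (\<sigma>\<^sup>2)) *\<^sub>C (cadjoint T (T (x (r n))) - d n)) \<longlonglongrightarrow>
      complex_of_real (inverse (\<sigma>\<^sup>2)) *\<^sub>C (cadjoint T y - 0)"
    unfolding scaleC_of_real using y d_lim
    by (intro tendsto_scaleR tendsto_diff tendsto_const blinfun.tendsto) (simp_all add: o_def)
  ultimately have v_lim: "(\<lambda>n. x (r n)) \<longlonglongrightarrow> v" by (simp add: v_def)
  have "norm v = 1"
    using tendsto_norm[OF v_lim] by (simp add: x(2) LIMSEQ_const_iff)
  have "(\<lambda>n. T (x (r n))) \<longlonglongrightarrow> T v" using v_lim by (intro blinfun.tendsto tendsto_const)
  then have "T v = y" using y unfolding o_def by (rule LIMSEQ_unique)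
  then have "v \<in> sv_space T \<sigma>" using \<sigma>0 by (simp add: sv_space_iff v_def)
  moreover have "cinner e v = 0" if "s \<ge> t" "e \<in> sv_space T s" for s e
  proof -
    have "(\<lambda>n. cinner e (x (r n))) \<longlonglongrightarrow> cinner e v"
      using v_lim by (rule bounded_linear.tendsto[OF bounded_linear_cinner_right])
    moreover have "cinner e (x (r n)) = 0" for n using x(1)[of "r n"] that by (auto simp: X_def)
    ultimately show ?thesis by (simp add: LIMSEQ_const_iff)
  qed
  \<comment> \<open>The limit is a singular vector for \<open>\<sigma>\<close>, where
    \<open>\<sigma> \<ge> t\<close>, and is at the same time orthogonal to all such vectors.\<close>
  ultimately have "cinner v v = 0" using t_le by blast
  then show False using \<open>norm v = 1\<close> by (simp add: cinner_eq_zero_iff)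
qed

text \<open>The discrete form of the inequality \<open>s\<^bsub>k+r\<^esub>(T + R) \<le> s\<^bsub>k\<^esub>(T)\<close> for singular values.\<close>

lemma singular_value_count_perturbation:
  assumes T: "T \<in> compact_ops" and R: "R \<in> finite_rank_ops"
  obtains r :: nat where "\<And>t F. t > 0 \<Longrightarrow> finite F \<Longrightarrow> F \<subseteq> {t..} \<Longrightarrow>
    (\<Sum>s\<in>F. sv_mult (T + R) s) \<le> r + (\<Sum>s\<in>{s. t \<le> s \<and> sv_mult T s \<noteq> 0}. sv_mult T s)"
proof -
  have TR: "T + R \<in> compact_ops" by (intro compact_ops_add finite_rank_compact T R)
  note b = compact_ops_bounded_ops[OF T] finite_rank_bounded_ops[OF R] compact_ops_bounded_ops[OF TR]
  obtain B where B: "finite B" "\<And>x. R x = orth_proj B (R x)"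
    using finite_rank_expansion[OF R] by metis
  obtain E where E: "sv_basis_family T E"
    using sv_bases[OF T] by blast
  obtain E' where E': "sv_basis_family (T + R) E'"
    using sv_bases[OF TR] by blast
  have Ep: "finite (E s)" "orthonormal (E s)" "complex_vector.span (E s) = sv_space T s"
    "card (E s) = sv_mult T s" if "s > 0" for s
    using E that by (auto simp: sv_basis_family_def)
  have "(\<Sum>s\<in>F. sv_mult (T + R) s) \<le> card B + (\<Sum>s\<in>{s. t \<le> s \<and> sv_mult T s \<noteq> 0}. sv_mult T s)"
    if t: "t > 0" and F: "finite F" "F \<subseteq> {t..}" for t F
  proof (rule ccontr)
    assume less: "\<not> ?thesis"
    define G where "G = {s. t \<le> s \<and> sv_mult T s \<noteq> 0}"
    have "finite G" "G \<subseteq> {0<..}" using finite_singular_values[OF T t] t by (auto simp: G_def)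
    note U = sv_bases_union[OF T E this]
    have "F \<subseteq> {0<..}" using F t by auto
    note U' = sv_bases_union[OF TR E' F(1) this]
    \<comment> \<open>The first group of conditions forces \<open>R x = 0\<close>, the second makes
      \<open>x\<close> orthogonal to the singular vectors of \<open>T\<close> at or above
      \<open>t\<close>. On such an \<open>x\<close> in the span for \<open>T + R\<close>, the norm
      of \<open>(T + R) x\<close> is at least \<open>t * norm x\<close>, while that of
      \<open>T x\<close> is smaller. The constant \<open>r\<close> of the statement is the size of
      the basis \<open>B\<close> of the range of \<open>R\<close>.\<close>
    define H where "H = cadjoint R ` B \<union> (\<Union>s\<in>G. E s)"
    have "finite H" using B(1) U(2) by (simp add: H_def)
    moreover have "card H < card (\<Union>s\<in>F. E' s)"
      using card_Un_le[of "cadjoint R ` B" "\<Union>s\<in>G. E s"] card_image_le[OF B(1), of "cadjoint R"] less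
      unfolding U'(3) H_def[symmetric] G_def[symmetric] U(3) by linarith
    ultimately obtain x where x: "x \<in> complex_vector.span (\<Union>s\<in>F. E' s)" "x \<noteq> 0"
      "\<And>h. h \<in> H \<Longrightarrow> cinner h x = 0"
      using orthogonal_vector_exists[OF U'(2,1)] by blast
    have "cinner h (R x) = 0" if "h \<in> B" for h
      using x(3)[of "cadjoint R h"] that by (simp add: H_def cinner_cadjoint[OF b(2)])
    then have "R x = 0" using B(2)[of x] by (simp add: orth_proj_def)
    moreover have "t * norm x \<le> norm ((T + R) x)"
      by (rule norm_ge_on_sv_span[OF b(3) t F])
        (use x(1) complex_vector.span_mono[OF U'(4)] in blast)
    moreover have "norm (T x) < t * norm x"
    proof (rule norm_less_on_sv_complement[OF T t x(2)])
      fix s e assume s: "t \<le> s" "e \<in> sv_space T s"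
      show "cinner e x = 0"
      proof (cases "s \<in> G")
        case True
        have "cinner x e = 0"
        proof (rule cinner_orth_span[of "E s"])
          show "e \<in> complex_vector.span (E s)" using Ep(3)[of s] s t by simp
          show "cinner x h = 0" if "h \<in> E s" for h
            using x(3)[of h] that True cinner_eq_0_commute by (auto simp: H_def)
        qed
        then show ?thesis using cinner_eq_0_commute by blast
      next
        case False
        \<comment> \<open>Multiplicity 0 here means a trivial space and not an infinite-dimensional
          one, because \<open>E s\<close> is a finite basis.\<close>
        then have "card (E s) = 0" using s t Ep(4)[of s] by (simp add: G_def)
        then have "E s = {}" using Ep(1)[of s] s t by simp
        then have "e = 0" using Ep(3)[of s] s t by auto
        then show ?thesis by simp
      qed
    qed
    ultimately show False by (simp add: blinfun.add_left)
  qed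
  then show ?thesis using that by blast
qed

text \<open>Abel summation as an induction. With \<open>a\<close> the smallest point,
  \<open>f\<close> is split into the constant \<open>f a\<close> and the excess \<open>g\<close>
  over it. The counting hypothesis at \<open>t = a\<close> controls the constant, the induction
  hypothesis controls \<open>g\<close>, and \<open>g b + f a = f b\<close> restores the term with
  \<open>r\<close>: up to \<open>r\<close> surplus points, none beyond \<open>b\<close>.\<close>

lemma weighted_sum_le:
  fixes m n :: "real \<Rightarrow> nat" and f :: "real \<Rightarrow> real"
  assumes "finite F" and G: "finite G" "G \<subseteq> {0<..}" and b: "b > 0"
    and "F \<subseteq> {0<..b}" and "mono_on {0<..} f" and "\<And>s. f s \<ge> 0"
    and "\<And>t. t \<in> F \<Longrightarrow> (\<Sum>s\<in>{s\<in>F. t \<le> s}. m s) \<le> r + (\<Sum>s\<in>{s\<in>G. t \<le> s}. n s)"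
  shows "(\<Sum>s\<in>F. real (m s) * f s) \<le> real r * f b + (\<Sum>s\<in>G. real (n s) * f s)"
  using assms(1,5-)
proof (induction F arbitrary: f rule: finite_linorder_min_induct)
  case empty
  then show ?case by (auto intro!: add_nonneg_nonneg sum_nonneg)
next
  case (insert a F)
  note mono = monotone_onD[OF insert.prems(2)]
  define g where "g s = max (f s - f a) 0" for s
  have a: "a > 0" "a \<le> b" using insert.prems(1) by auto
  have "(\<Sum>s\<in>F. real (m s) * g s) \<le> real r * g b + (\<Sum>s\<in>G. real (n s) * g s)"
  proof (rule insert.IH)
    show "mono_on {0<..} g"
      by (rule monotone_onI) (use mono in \<open>force simp: g_def\<close>)
    show "(\<Sum>s\<in>{s\<in>F. t \<le> s}. m s) \<le> r + (\<Sum>s\<in>{s\<in>G. t \<le> s}. n s)" if "t \<in> F" for t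
    proof -
      have "{s \<in> insert a F. t \<le> s} = {s \<in> F. t \<le> s}" using insert.hyps(2) that by force
      then show ?thesis using insert.prems(4)[of t] that by simp
    qed
  qed (use insert.prems in \<open>auto simp: g_def\<close>)
  moreover have "g b = f b - f a" using mono[of a b] a b by (simp add: g_def)
  moreover have "(\<Sum>s\<in>F. real (m s) * f s) = (\<Sum>s\<in>F. real (m s) * g s) + f a * (\<Sum>s\<in>F. m s)"
  proof -
    have "f s = g s + f a" if "s \<in> F" for s
      using mono[of a s] insert.hyps(2) insert.prems(1) that by (fastforce simp: g_def)
    then show ?thesis
      by (simp add: sum_distrib_left distrib_left sum.distrib mult.commute cong: sum.cong)
  qed
  moreover have "f a * real (\<Sum>s\<in>insert a F. m s) \<le> f a * real (r + (\<Sum>s\<in>{s\<in>G. a \<le> s}. n s))"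
  proof -
    have "{s \<in> insert a F. a \<le> s} = insert a F" using insert.hyps(2) by force
    then have "(\<Sum>s\<in>insert a F. m s) \<le> r + (\<Sum>s\<in>{s\<in>G. a \<le> s}. n s)"
      using insert.prems(4)[of a] by simp
    then show ?thesis using insert.prems(3)[of a] by (intro mult_left_mono of_nat_mono)
  qed
  moreover have "f a * real (\<Sum>s\<in>{s\<in>G. a \<le> s}. n s) + (\<Sum>s\<in>G. real (n s) * g s)
      \<le> (\<Sum>s\<in>G. real (n s) * f s)"
  proof -
    have "f a * real (\<Sum>s\<in>{s\<in>G. a \<le> s}. n s) = (\<Sum>s\<in>G. if a \<le> s then f a * real (n s) else 0)"
      using G(1) by (simp add: sum_distrib_left sum.inter_filter if_distrib cong: if_cong)
    moreover have "(if a \<le> s then f a * real (n s) else 0) + real (n s) * g s \<le> real (n s) * f s"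
      if "s \<in> G" for s
    proof (cases "a \<le> s")
      case True
      then have "g s = f s - f a" using mono[of a s] a by (simp add: g_def)
      then show ?thesis using True by (simp add: right_diff_distrib mult.commute)
    next
      case False
      then have "g s = 0" using mono[of s a] a that G(2) by (auto simp: g_def)
      then show ?thesis using False insert.prems(3)[of s] by simp
    qed
    ultimately show ?thesis by (simp add: sum_mono flip: sum.distrib)
  qed
  moreover have "a \<notin> F" using insert.hyps(2) by blast
  ultimately show ?case using insert.hyps(1) by (simp add: algebra_simps)
qed

lemma singular_value_le_norm:
  assumes T: "T \<in> compact_ops" and s: "s > 0" "sv_mult T s \<noteq> 0"
  shows "s \<le> norm T"
proof -
  note Tb = compact_ops_bounded_ops[OF T]
  obtain B where B: "finite B" "orthonormal B" "complex_vector.span B = sv_space T s"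
    "complex_vector.dim (sv_space T s) = card B"
    using orthonormal_basis_exists[OF sv_space_subspace[OF Tb] sv_space_finite_cdim[OF T s(1)]] .
  then obtain e where e: "e \<in> B" using s(2) by (force simp: sv_mult_eq_dim)
  then have "e \<in> sv_space T s" using B(3) complex_vector.span_base by blast
  then have "(norm (T e))\<^sup>2 = s\<^sup>2" using norm_sv_space[OF Tb] orthonormal_norm[OF B(2) e] by simp
  then have "norm (T e) = s" using s(1) by (simp add: power2_eq_iff_nonneg)
  then show ?thesis using norm_blinfun[of T e] orthonormal_norm[OF B(2) e] by simp
qed

lemma schatten_ops_iff:
  "T \<in> schatten_ops q \<longleftrightarrow>
    T \<in> compact_ops \<and> (\<lambda>s. real (sv_mult T s) * s powr q) summable_on {0<..}"
  by (simp add: schatten_ops_def sv_mult_def)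

text \<open>The counting inequality is summed against the increasing weight \<open>s powr q\<close>;
  the finite rank summand costs at most \<open>real r * b powr q\<close>, uniformly in the finite
  set \<open>F\<close>.\<close>

lemma schatten_add_finite_rank:
  assumes T: "T \<in> schatten_ops q" and q: "q \<ge> 0" and R: "R \<in> finite_rank_ops"
  shows "T + R \<in> schatten_ops q"
proof -
  have Tc: "T \<in> compact_ops" and sm: "(\<lambda>s. real (sv_mult T s) * s powr q) summable_on {0<..}"
    using T by (auto simp: schatten_ops_iff)
  have TR: "T + R \<in> compact_ops" by (intro compact_ops_add finite_rank_compact Tc R)
  obtain r :: nat where r: "\<And>t F. t > 0 \<Longrightarrow> finite F \<Longrightarrow> F \<subseteq> {t..} \<Longrightarrow>
    (\<Sum>s\<in>F. sv_mult (T + R) s) \<le> r + (\<Sum>s\<in>{s. t \<le> s \<and> sv_mult T s \<noteq> 0}. sv_mult T s)"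
    using singular_value_count_perturbation[OF Tc R] by blast
  \<comment> \<open>A bound for all singular values; the added 1 keeps it positive when
    \<open>T + R\<close> is zero.\<close>
  define b where "b = norm (T + R) + 1"
  have b: "b > 0" by (simp add: b_def add_nonneg_pos)
  let ?M = "real r * b powr q + infsum (\<lambda>s. real (sv_mult T s) * s powr q) {0<..}"
  have "(\<Sum>s\<in>F. real (sv_mult (T + R) s) * s powr q) \<le> ?M" if F: "finite F" "F \<subseteq> {0<..}" for F
  proof (cases "\<exists>s\<in>F. sv_mult (T + R) s \<noteq> 0")
    case False
    then have "(\<Sum>s\<in>F. real (sv_mult (T + R) s) * s powr q) = 0" by simp
    also have "\<dots> \<le> ?M" by (intro add_nonneg_nonneg infsum_nonneg) auto
    finally show ?thesis .
  next
    case True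
    \<comment> \<open>Points of multiplicity 0 have to go, because only genuine singular values are
      bounded by the norm.\<close>
    define F' where "F' = {s\<in>F. sv_mult (T + R) s \<noteq> 0}"
    have F': "finite F'" "F' \<noteq> {}" "F' \<subseteq> {0<..}" using F True by (auto simp: F'_def)
    \<comment> \<open>Cutting at the smallest point of \<open>F'\<close> makes \<open>G\<close>
      finite and leaves the counts at thresholds in \<open>F'\<close> unchanged.\<close>
    define G where "G = {s. Min F' \<le> s \<and> sv_mult T s \<noteq> 0}"
    have "Min F' > 0" using F' Min_in by blast
    then have G: "finite G" "G \<subseteq> {0<..}"
      using finite_singular_values[OF Tc] by (auto simp: G_def)
    have "(\<Sum>s\<in>F. real (sv_mult (T + R) s) * s powr q)
        = (\<Sum>s\<in>F'. real (sv_mult (T + R) s) * s powr q)"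
      unfolding F'_def using F by (intro sum.mono_neutral_right) auto
    also have "\<dots> \<le> real r * b powr q + (\<Sum>s\<in>G. real (sv_mult T s) * s powr q)"
    proof (rule weighted_sum_le[OF F'(1) G b])
      show "F' \<subseteq> {0<..b}"
        using F' singular_value_le_norm[OF TR] by (force simp: F'_def b_def)
      show "mono_on {0<..} (\<lambda>s. s powr q)"
        by (rule monotone_onI) (use q in \<open>auto intro: powr_mono2\<close>)
      show "(\<Sum>s\<in>{s\<in>F'. t \<le> s}. sv_mult (T + R) s) \<le> r + (\<Sum>s\<in>{s\<in>G. t \<le> s}. sv_mult T s)"
        if "t \<in> F'" for t
      proof -
        have "Min F' \<le> t" using F'(1) that by simp
        then have "{s\<in>G. t \<le> s} = {s. t \<le> s \<and> sv_mult T s \<noteq> 0}" by (auto simp: G_def)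
        then show ?thesis using r[of t "{s\<in>F'. t \<le> s}"] F' that by auto
      qed
    qed auto
    also have "\<dots> \<le> ?M"
      using finite_sum_le_infsum[OF sm G] by simp
    finally show ?thesis .
  qed
  then have "(\<lambda>s. real (sv_mult (T + R) s) * s powr q) summable_on {0<..}"
    by (intro nonneg_bdd_above_summable_on bdd_aboveI[of _ ?M]) auto
  then show ?thesis using TR by (simp add: schatten_ops_iff)
qed

section \<open>Operator-valued power series\<close>

text \<open>The disc need not lie in a given domain, so that algebra and division can be done at a
  single point; over an open domain the disc can be shrunk afterwards.\<close>

definition op_analytic_at :: "(complex \<Rightarrow> 'a::chilbert_space \<Rightarrow>\<^sub>L 'a) \<Rightarrow> complex \<Rightarrow> bool"
  where "op_analytic_at F z \<longleftrightarrow> (\<exists>r>0. \<exists>C. range C \<subseteq> bounded_ops \<and>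
    (\<forall>w\<in>ball z r. (\<lambda>k. (w - z) ^ k *\<^sub>C C k) sums F w))"

lemma op_analytic_atI:
  assumes "r > 0" "\<And>k. C k \<in> bounded_ops"
    and "\<And>w. w \<in> ball z r \<Longrightarrow> (\<lambda>k. (w - z) ^ k *\<^sub>C C k) sums F w"
  shows "op_analytic_at F z"
  unfolding op_analytic_at_def
  by (rule exI[of _ r], intro conjI assms(1), rule exI[of _ C]) (use assms(2,3) in blast)

lemma op_analytic_atE:
  assumes "op_analytic_at F z"
  obtains r C where "r > 0" "\<And>k. C k \<in> bounded_ops"
    "\<And>w. w \<in> ball z r \<Longrightarrow> (\<lambda>k. (w - z) ^ k *\<^sub>C C k) sums F w"
  using assms unfolding op_analytic_at_def by (metis rangeI subsetD)

lemma op_analytic_at_cong: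
  assumes "op_analytic_at F z" and "\<forall>\<^sub>F w in nhds z. F w = G w"
  shows "op_analytic_at G z"
proof -
  obtain r C where C: "r > 0" "\<And>k. C k \<in> bounded_ops"
    "\<And>w. w \<in> ball z r \<Longrightarrow> (\<lambda>k. (w - z) ^ k *\<^sub>C C k) sums F w"
    using op_analytic_atE[OF assms(1)] by blast
  obtain d where d: "d > 0" "\<And>w. dist w z < d \<Longrightarrow> F w = G w"
    using assms(2) unfolding eventually_nhds_metric by blast
  show ?thesis
  proof (rule op_analytic_atI[of "min r d" C])
    fix w assume "w \<in> ball z (min r d)"
    then show "(\<lambda>k. (w - z) ^ k *\<^sub>C C k) sums G w"
      using C(3)[of w] d(2)[of w] by (simp add: dist_commute)
  qed (use C d in auto)
qed

lemma op_analytic_on_iff: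
  assumes "open \<Omega>"
  shows "op_analytic_on F \<Omega> \<longleftrightarrow> (\<forall>z\<in>\<Omega>. op_analytic_at F z)"
proof
  assume "op_analytic_on F \<Omega>"
  then show "\<forall>z\<in>\<Omega>. op_analytic_at F z" unfolding op_analytic_on_def op_analytic_at_def by meson
next
  assume an: "\<forall>z\<in>\<Omega>. op_analytic_at F z"
  show "op_analytic_on F \<Omega>"
    unfolding op_analytic_on_def
  proof
    fix z assume z: "z \<in> \<Omega>"
    obtain r C where C: "r > 0" "\<And>k. C k \<in> bounded_ops"
      "\<And>w. w \<in> ball z r \<Longrightarrow> (\<lambda>k. (w - z) ^ k *\<^sub>C C k) sums F w"
      using op_analytic_atE an z by blast
    obtain d where d: "d > 0" "ball z d \<subseteq> \<Omega>" using assms z open_contains_ball by blast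
    have "min r d > 0" using C(1) d(1) by simp
    moreover have "ball z (min r d) \<subseteq> \<Omega>" using d(2) by auto
    moreover have "range C \<subseteq> bounded_ops" using C(2) by blast
    moreover have "\<forall>w\<in>ball z (min r d). (\<lambda>k. (w - z) ^ k *\<^sub>C C k) sums F w" using C(3) by simp
    ultimately show "\<exists>r>0. \<exists>C. ball z r \<subseteq> \<Omega> \<and> range C \<subseteq> bounded_ops \<and>
       (\<forall>w\<in>ball z r. (\<lambda>k. (w - z) ^ k *\<^sub>C C k) sums F w)" by blast
  qed
qed

lemma power_series_center: "(\<lambda>k. (z - z) ^ k *\<^sub>C C k) sums C 0"
  for C :: "nat \<Rightarrow> 'a::complex_normed_vector"
  using sums_finite[of "{0}" "\<lambda>k. (z - z) ^ k *\<^sub>C C k"] scaleC_of_real[of 1 "C 0"]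
  by (simp add: power_0_left)

lemma power_series_tail:
  fixes C :: "nat \<Rightarrow> 'a::complex_normed_vector"
  assumes "(\<lambda>k. u ^ k *\<^sub>C C k) sums s"
  shows "(\<lambda>k. u ^ Suc k *\<^sub>C C (Suc k)) sums (s - C 0)"
  using assms scaleC_of_real[of 1 "C 0"]
  by (subst sums_Suc_iff[of "\<lambda>k. u ^ k *\<^sub>C C k"]) simp

lemma sums_scaleC: "f sums s \<Longrightarrow> (\<lambda>k. c *\<^sub>C f k) sums (c *\<^sub>C s)"
  for s :: "'a::complex_normed_vector"
  by (rule bounded_linear.sums[OF bounded_linear_scaleC_comp[OF bounded_linear_ident]])

lemma op_analytic_at_eventually_bounded_ops:
  assumes "op_analytic_at F z"
  shows "\<forall>\<^sub>F w in nhds z. F w \<in> bounded_ops"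
proof -
  obtain r C where C: "r > 0" "\<And>k. C k \<in> bounded_ops"
    "\<And>w. w \<in> ball z r \<Longrightarrow> (\<lambda>k. (w - z) ^ k *\<^sub>C C k) sums F w"
    using op_analytic_atE[OF assms] by blast
  have "F w \<in> bounded_ops" if "dist w z < r" for w
  proof -
    have "(\<lambda>k. (w - z) ^ k *\<^sub>C C k) sums F w" using that by (intro C(3)) (simp add: dist_commute)
    from bounded_linear.sums[OF blinfun.bounded_linear_left this]
    have lim: "(\<lambda>k. (w - z) ^ k *\<^sub>C C k x) sums F w x" for x
      by (simp add: blinfun_apply_scaleC)
    have "F w (c *\<^sub>C x) = c *\<^sub>C F w x" for c x
    proof (rule sums_unique2[OF lim])
      show "(\<lambda>k. (w - z) ^ k *\<^sub>C C k (c *\<^sub>C x)) sums (c *\<^sub>C F w x)"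
        using sums_scaleC[OF lim[of x], of c] by (simp add: bounded_ops_scaleC[OF C(2)] mult.commute)
    qed
    then show ?thesis by (simp add: bounded_ops_def)
  qed
  then show ?thesis using C(1) unfolding eventually_nhds_metric by blast
qed

lemma op_analytic_at_bounded_ops: "op_analytic_at F z \<Longrightarrow> F z \<in> bounded_ops"
  using eventually_nhds_x_imp_x[OF op_analytic_at_eventually_bounded_ops] by blast

lemma op_analytic_at_diff:
  assumes "op_analytic_at F z" "op_analytic_at G z"
  shows "op_analytic_at (\<lambda>w. F w - G w) z"
proof -
  obtain r C where C: "r > 0" "\<And>k. C k \<in> bounded_ops"
    "\<And>w. w \<in> ball z r \<Longrightarrow> (\<lambda>k. (w - z) ^ k *\<^sub>C C k) sums F w"
    using op_analytic_atE[OF assms(1)] by blast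
  obtain r' C' where C': "r' > 0" "\<And>k. C' k \<in> bounded_ops"
    "\<And>w. w \<in> ball z r' \<Longrightarrow> (\<lambda>k. (w - z) ^ k *\<^sub>C C' k) sums G w"
    using op_analytic_atE[OF assms(2)] by blast
  show ?thesis
  proof (rule op_analytic_atI[of "min r r'" "\<lambda>k. C k - C' k"])
    show "(\<lambda>k. (w - z) ^ k *\<^sub>C (C k - C' k)) sums (F w - G w)" if "w \<in> ball z (min r r')" for w
      using sums_diff[OF C(3)[of w] C'(3)[of w]] that
      by (simp add: complex_vector.scale_right_diff_distrib)
  qed (use C C' in \<open>auto intro: bounded_ops_diff\<close>)
qed

lemma op_analytic_at_linear_image:
  assumes "op_analytic_at F z" and "bounded_linear L"
    and sc: "\<And>c X. L (c *\<^sub>C X) = c *\<^sub>C L X" and bo: "\<And>X. X \<in> bounded_ops \<Longrightarrow> L X \<in> bounded_ops"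
  shows "op_analytic_at (\<lambda>w. L (F w)) z"
proof -
  obtain r C where C: "r > 0" "\<And>k. C k \<in> bounded_ops"
    "\<And>w. w \<in> ball z r \<Longrightarrow> (\<lambda>k. (w - z) ^ k *\<^sub>C C k) sums F w"
    using op_analytic_atE[OF assms(1)] by blast
  show ?thesis
  proof (rule op_analytic_atI[of r "\<lambda>k. L (C k)"])
    show "(\<lambda>k. (w - z) ^ k *\<^sub>C L (C k)) sums L (F w)" if "w \<in> ball z r" for w
      using bounded_linear.sums[OF assms(2) C(3)[OF that]] by (simp add: sc)
  qed (use C bo in auto)
qed

lemma blinfun_compose_scaleC_left: "((c *\<^sub>C S) o\<^sub>L T) = c *\<^sub>C (S o\<^sub>L T)"
  by (rule blinfun_eqI) (simp add: blinfun_apply_scaleC)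

lemma blinfun_compose_scaleC_right:
  "S \<in> bounded_ops \<Longrightarrow> (S o\<^sub>L (c *\<^sub>C T)) = c *\<^sub>C (S o\<^sub>L T)"
  by (rule blinfun_eqI) (simp add: blinfun_apply_scaleC bounded_ops_scaleC)

lemma op_analytic_at_compose_right:
  "op_analytic_at F z \<Longrightarrow> T \<in> bounded_ops \<Longrightarrow> op_analytic_at (\<lambda>w. F w o\<^sub>L T) z"
  by (rule op_analytic_at_linear_image)
    (simp_all add: blinfun_compose_scaleC_left bounded_ops_compose
      bounded_bilinear.bounded_linear_left[OF bounded_bilinear_blinfun_compose])

lemma op_analytic_at_compose_left:
  "op_analytic_at F z \<Longrightarrow> S \<in> bounded_ops \<Longrightarrow> op_analytic_at (\<lambda>w. S o\<^sub>L F w) z"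
  by (rule op_analytic_at_linear_image)
    (simp_all add: blinfun_compose_scaleC_right bounded_ops_compose
      bounded_bilinear.bounded_linear_right[OF bounded_bilinear_blinfun_compose])

section \<open>Coefficient bounds, continuity and division\<close>

text \<open>A Cauchy estimate without integrals: the terms of the convergent series at
  \<open>z + \<rho>\<close> tend to 0 and are therefore bounded.\<close>

lemma power_series_coeff_bound:
  fixes C :: "nat \<Rightarrow> 'a::complex_normed_vector"
  assumes "\<And>w. w \<in> ball z r \<Longrightarrow> (\<lambda>k. (w - z) ^ k *\<^sub>C C k) sums F w" and "0 < \<rho>" "\<rho> < r"
  obtains M where "M > 0" "\<And>k. norm (C k) * \<rho> ^ k \<le> M"
proof -
  have "(\<lambda>k. complex_of_real \<rho> ^ k *\<^sub>C C k) sums F (z + complex_of_real \<rho>)"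
    using assms(1)[of "z + complex_of_real \<rho>"] assms(2,3) by (simp add: dist_norm)
  then have "(\<lambda>k. complex_of_real \<rho> ^ k *\<^sub>C C k) \<longlonglongrightarrow> 0"
    using sums_summable summable_LIMSEQ_zero by blast
  then have "Bseq (\<lambda>k. complex_of_real \<rho> ^ k *\<^sub>C C k)"
    using convergentI convergent_imp_Bseq by blast
  then obtain M where "M > 0" "\<And>k. norm (complex_of_real \<rho> ^ k *\<^sub>C C k) \<le> M"
    unfolding Bseq_def by blast
  then show ?thesis using that assms(2) by (simp add: norm_scaleC norm_power mult.commute)
qed

text \<open>Comparing the series without its constant term to a geometric one gives a Lipschitz
  bound at \<open>z\<close>.\<close>

lemma op_analytic_at_tendsto:
  assumes "op_analytic_at F z"
  shows "(F \<longlongrightarrow> F z) (at z)"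
proof -
  obtain r C where C: "r > 0" "\<And>k. C k \<in> bounded_ops"
    "\<And>w. w \<in> ball z r \<Longrightarrow> (\<lambda>k. (w - z) ^ k *\<^sub>C C k) sums F w"
    using op_analytic_atE[OF assms] by blast
  define \<rho> where "\<rho> = r / 2"
  have \<rho>: "0 < \<rho>" "\<rho> < r" using C(1) by (auto simp: \<rho>_def)
  obtain M where M: "M > 0" "\<And>k. norm (C k) * \<rho> ^ k \<le> M"
    using power_series_coeff_bound[OF C(3) \<rho>] by blast
  have F0: "F z = C 0" using C(1) C(3)[of z] power_series_center sums_unique2 by auto
  have bound: "norm (F w - F z) \<le> 2 * M / \<rho> * dist w z" if w: "dist w z < \<rho> / 2" for w
  proof -
    define q where "q = dist w z / \<rho>"
    have q: "0 \<le> q" "q < 1 / 2" "\<bar>q\<bar> < 1" using w \<rho> by (auto simp: q_def field_simps)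
    have "(\<lambda>k. (w - z) ^ k *\<^sub>C C k) sums F w" using w \<rho> by (intro C(3)) (simp add: dist_commute)
    then have "(\<lambda>k. (w - z) ^ Suc k *\<^sub>C C (Suc k)) sums (F w - F z)"
      unfolding F0 by (rule power_series_tail)
    moreover have "(\<lambda>k. M * q * q ^ k) sums (M * q * (1 / (1 - q)))"
      using q by (intro sums_mult geometric_sums) simp
    moreover have "norm ((w - z) ^ Suc k *\<^sub>C C (Suc k)) \<le> M * q * q ^ k" for k
    proof -
      have "norm ((w - z) ^ Suc k *\<^sub>C C (Suc k)) = norm (C (Suc k)) * \<rho> ^ Suc k * q ^ Suc k"
        using \<rho> by (simp add: norm_scaleC norm_power norm_mult q_def dist_norm power_divide)
      also have "\<dots> \<le> M * q ^ Suc k" using M(2)[of "Suc k"] q by (intro mult_right_mono) auto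
      finally show ?thesis by (simp add: mult.assoc)
    qed
    ultimately have "norm (F w - F z) \<le> M * q * (1 / (1 - q))" by (rule norm_sums_le)
    also have "\<dots> \<le> M * q * 2" using q M(1) by (intro mult_left_mono) (auto simp: field_simps)
    also have "\<dots> = 2 * M / \<rho> * dist w z" by (simp add: q_def)
    finally show ?thesis .
  qed
  have "((\<lambda>w. F w - F z) \<longlongrightarrow> 0) (at z)"
  proof (rule Lim_null_comparison)
    show "\<forall>\<^sub>F w in at z. norm (F w - F z) \<le> 2 * M / \<rho> * dist w z"
      unfolding eventually_at using bound \<rho> by (intro exI[of _ "\<rho> / 2"]) auto
    have "((\<lambda>w. 2 * M / \<rho> * dist w z) \<longlongrightarrow> 2 * M / \<rho> * dist z z) (at z)"
      by (intro tendsto_intros)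
    then show "((\<lambda>w. 2 * M / \<rho> * dist w z) \<longlongrightarrow> 0) (at z)" by simp
  qed
  then show ?thesis by (rule LIM_zero_cancel)
qed

text \<open>The constant coefficient is \<open>F z\<close>, which is 0, so division shifts the
  coefficients by one and the value at \<open>z\<close> becomes the former first
  coefficient.\<close>

lemma op_analytic_at_divide_center:
  assumes "op_analytic_at F z" "F z = 0"
  obtains G where "op_analytic_at G z" "\<And>w. w \<noteq> z \<Longrightarrow> G w = inverse (w - z) *\<^sub>C F w"
proof -
  obtain r C where C: "r > 0" "\<And>k. C k \<in> bounded_ops"
    "\<And>w. w \<in> ball z r \<Longrightarrow> (\<lambda>k. (w - z) ^ k *\<^sub>C C k) sums F w"
    using op_analytic_atE[OF assms(1)] by blast
  have C0: "C 0 = 0"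
    using C(1) C(3)[of z] power_series_center sums_unique2 assms(2) by (metis centre_in_ball)
  define G where "G w = (if w = z then C 1 else inverse (w - z) *\<^sub>C F w)" for w
  have "op_analytic_at G z"
  proof (rule op_analytic_atI[of r "\<lambda>k. C (Suc k)"])
    fix w assume w: "w \<in> ball z r"
    show "(\<lambda>k. (w - z) ^ k *\<^sub>C C (Suc k)) sums G w"
    proof (cases "w = z")
      case True
      then show ?thesis using power_series_center[of z "\<lambda>k. C (Suc k)"] by (simp add: G_def)
    next
      case False
      have "(\<lambda>k. (w - z) ^ Suc k *\<^sub>C C (Suc k)) sums F w"
        using power_series_tail[OF C(3)[OF w]] by (simp add: C0)
      from sums_scaleC[OF this, of "inverse (w - z)"] show ?thesis
        using False by (simp add: G_def flip: mult.assoc)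
    qed
  qed (use C in auto)
  then show ?thesis using that by (simp add: G_def)
qed

text \<open>The coefficients \<open>G k\<close> of the quotient solve \<open>d G\<^sub>0 = C\<^sub>0\<close> and \<open>d G\<^sub>k\<^sub>+\<^sub>1 + G\<^sub>k = C\<^sub>k\<^sub>+\<^sub>1\<close>
  with \<open>d = z - z\<^sub>0\<close>.\<close>

lemma op_analytic_at_divide_off_center:
  fixes F :: "complex \<Rightarrow> 'a::chilbert_space \<Rightarrow>\<^sub>L 'a"
  assumes "op_analytic_at F z" "z \<noteq> z\<^sub>0"
  shows "op_analytic_at (\<lambda>w. inverse (w - z\<^sub>0) *\<^sub>C F w) z"
proof -
  obtain r C where C: "r > 0" "\<And>k. C k \<in> bounded_ops"
    "\<And>w. w \<in> ball z r \<Longrightarrow> (\<lambda>k. (w - z) ^ k *\<^sub>C C k) sums F w"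
    using op_analytic_atE[OF assms(1)] by blast
  define d where "d = z - z\<^sub>0"
  have d: "d \<noteq> 0" using assms(2) by (simp add: d_def)
  \<comment> \<open>Below \<open>r\<close> for the bound on the coefficients \<open>C\<close>; below
    \<open>cmod d\<close> so that the disc avoids \<open>z\<^sub>0\<close> and \<open>N\<close>
    comes out positive.\<close>
  define \<rho> where "\<rho> = min r (cmod d) / 2"
  have \<rho>: "0 < \<rho>" "\<rho> < r" "\<rho> < cmod d" using C(1) d by (auto simp: \<rho>_def min_def)
  obtain M where M: "M > 0" "\<And>k. norm (C k) * \<rho> ^ k \<le> M"
    using power_series_coeff_bound[OF C(3) \<rho>(1,2)] by blast
  define G where "G = rec_nat (inverse d *\<^sub>C C 0) (\<lambda>k X. inverse d *\<^sub>C (C (Suc k) - X))"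
  have G: "G 0 = inverse d *\<^sub>C C 0" "G (Suc k) = inverse d *\<^sub>C (C (Suc k) - G k)" for k
    by (simp_all add: G_def)
  have dG: "d *\<^sub>C G 0 = C 0" "d *\<^sub>C G (Suc k) = C (Suc k) - G k" for k
    using d by (simp_all add: G scaleC_scaleC)
  have G_ops: "G k \<in> bounded_ops" for k
    by (induction k) (simp_all add: G bounded_ops_scale bounded_ops_diff C(2))
  \<comment> \<open>Chosen as the solution of \<open>M + \<rho> * N = cmod d * N\<close>, so that
    the bound reproduces itself under the recursion for \<open>G\<close>.\<close>
  define N where "N = M / (cmod d - \<rho>)"
  have N: "N > 0" "M + \<rho> * N = cmod d * N" using M(1) \<rho> by (auto simp: N_def field_simps)
  have G_bound: "norm (G k) * \<rho> ^ k \<le> N" for k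
  proof (induction k)
    case 0
    have "cmod d * norm (G 0) = norm (C 0)" by (metis dG(1) norm_scaleC)
    also have "\<dots> \<le> M" using M(2)[of 0] by simp
    also have "\<dots> \<le> cmod d * N" using mult_pos_pos[OF \<rho>(1) N(1)] N(2) by linarith
    finally show ?case using d by simp
  next
    case (Suc k)
    have "cmod d * (norm (G (Suc k)) * \<rho> ^ Suc k) = norm (C (Suc k) - G k) * \<rho> ^ Suc k"
      by (simp flip: dG(2) norm_scaleC mult.assoc)
    also have "\<dots> \<le> (norm (C (Suc k)) + norm (G k)) * \<rho> ^ Suc k"
      using \<rho>(1) by (intro mult_right_mono norm_triangle_ineq4) simp
    also have "\<dots> = norm (C (Suc k)) * \<rho> ^ Suc k + \<rho> * (norm (G k) * \<rho> ^ k)"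
      by (simp add: algebra_simps)
    also have "\<dots> \<le> M + \<rho> * N"
      using M(2)[of "Suc k"] Suc \<rho>(1) by (intro add_mono mult_left_mono) auto
    finally show ?case using d N(2) by simp
  qed
  show ?thesis
  proof (rule op_analytic_atI[of \<rho> G, OF \<rho>(1) G_ops])
    fix w assume w: "w \<in> ball z \<rho>"
    define u where "u = w - z"
    have u: "cmod u < \<rho>" using w by (simp add: u_def dist_norm norm_minus_commute)
    have "summable (\<lambda>k. u ^ k *\<^sub>C G k)"
    proof (rule summable_comparison_test')
      show "summable (\<lambda>k. N * (cmod u / \<rho>) ^ k)"
        using u \<rho>(1) by (intro summable_mult summable_geometric) simp
      fix k
      have "norm (u ^ k *\<^sub>C G k) = norm (G k) * \<rho> ^ k * (cmod u / \<rho>) ^ k"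
        using \<rho>(1) by (simp add: norm_scaleC norm_power power_divide)
      also have "\<dots> \<le> N * (cmod u / \<rho>) ^ k"
        using G_bound[of k] \<rho>(1) by (intro mult_right_mono) auto
      finally show "norm (u ^ k *\<^sub>C G k) \<le> N * (cmod u / \<rho>) ^ k" .
    qed
    then obtain S where S: "(\<lambda>k. u ^ k *\<^sub>C G k) sums S" by (auto simp: summable_def)
    \<comment> \<open>The terms of \<open>u\<close> times the series \<open>S\<close>, moved up by
      one index, so that adding \<open>d\<close> times the series gives the terms of
      \<open>F w\<close> one by one.\<close>
    define H where "H k = (case k of 0 \<Rightarrow> 0 | Suc j \<Rightarrow> u ^ Suc j *\<^sub>C G j)" for k
    have "(\<lambda>k. H (Suc k)) sums (u *\<^sub>C S)" using sums_scaleC[OF S, of u] by (simp add: H_def)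
    then have "H sums (u *\<^sub>C S)" by (subst (asm) sums_Suc_iff) (simp add: H_def)
    from sums_add[OF sums_scaleC[OF S, of d] this]
    have "(\<lambda>k. d *\<^sub>C u ^ k *\<^sub>C G k + H k) sums ((d + u) *\<^sub>C S)"
      by (simp add: scaleC_add_left)
    moreover have "d *\<^sub>C u ^ k *\<^sub>C G k + H k = u ^ k *\<^sub>C C k" for k
    proof -
      have "d *\<^sub>C u ^ k *\<^sub>C G k = u ^ k *\<^sub>C d *\<^sub>C G k" by (simp add: scaleC_scaleC mult.commute)
      then show ?thesis
        by (cases k) (simp_all add: dG H_def complex_vector.scale_right_diff_distrib)
    qed
    ultimately have "(\<lambda>k. u ^ k *\<^sub>C C k) sums ((d + u) *\<^sub>C S)" by simp
    moreover have "(\<lambda>k. u ^ k *\<^sub>C C k) sums F w" using w \<rho>(2) unfolding u_def by (intro C(3)) simp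
    ultimately have "F w = (d + u) *\<^sub>C S" using sums_unique2 by blast
    moreover have "d + u = w - z\<^sub>0" by (simp add: d_def u_def)
    moreover have "w - z\<^sub>0 \<noteq> 0"
      using u \<rho>(3) \<open>d + u = w - z\<^sub>0\<close> by (metis add_eq_0_iff norm_minus_cancel not_less_iff_gr_or_eq order_less_trans)
    ultimately have "inverse (w - z\<^sub>0) *\<^sub>C F w = S" by simp
    then show "(\<lambda>k. (w - z) ^ k *\<^sub>C G k) sums (inverse (w - z\<^sub>0) *\<^sub>C F w)" using S by (simp add: u_def)
  qed
qed

lemma op_analytic_divide:
  assumes "\<forall>z\<in>\<Omega>. op_analytic_at F z" "z\<^sub>0 \<in> \<Omega>" "F z\<^sub>0 = 0"
  obtains G where "\<forall>z\<in>\<Omega>. op_analytic_at G z" "\<And>w. w \<noteq> z\<^sub>0 \<Longrightarrow> G w = inverse (w - z\<^sub>0) *\<^sub>C F w"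
proof -
  obtain G where G: "op_analytic_at G z\<^sub>0" "\<And>w. w \<noteq> z\<^sub>0 \<Longrightarrow> G w = inverse (w - z\<^sub>0) *\<^sub>C F w"
    using op_analytic_at_divide_center assms by metis
  have "op_analytic_at G z" if "z \<in> \<Omega>" "z \<noteq> z\<^sub>0" for z
  proof (rule op_analytic_at_cong)
    show "op_analytic_at (\<lambda>w. inverse (w - z\<^sub>0) *\<^sub>C F w) z"
      using assms(1) that by (intro op_analytic_at_divide_off_center) auto
    have "\<forall>\<^sub>F w in nhds z. w \<in> - {z\<^sub>0}" using that by (intro eventually_nhds_in_open) auto
    then show "\<forall>\<^sub>F w in nhds z. inverse (w - z\<^sub>0) *\<^sub>C F w = G w"
      by eventually_elim (simp add: G(2))
  qed
  then show ?thesis using that G by metis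
qed

section \<open>Splitting off a factor\<close>

lemma orth_proj_operator:
  fixes B :: "'a::chilbert_space set"
  assumes "finite B" "orthonormal B"
  obtains P where "P \<in> projections" "op_ran P = complex_vector.span B"
proof -
  have "bounded_linear (orth_proj B)"
    unfolding orth_proj_def
    by (intro bounded_linear_sum bounded_linear_compose[OF bounded_linear_scaleC_left]
        bounded_linear_cinner_right)
  then have P: "blinfun_apply (Blinfun (orth_proj B)) = orth_proj B"
    by (rule bounded_linear_Blinfun_apply)
  have "orth_proj B (c *\<^sub>C x) = c *\<^sub>C orth_proj B x" for c x
    by (simp add: orth_proj_def cinner_scaleC_right complex_vector.scale_sum_right)
  then have "Blinfun (orth_proj B) \<in> bounded_ops" by (simp add: bounded_ops_def P)
  moreover have "orth_proj B (orth_proj B x) = orth_proj B x" for x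
    using orth_proj_eq[OF assms orth_proj_in_span] .
  ultimately have "Blinfun (orth_proj B) \<in> projections"
    by (auto simp: projections_def P intro!: blinfun_eqI)
  moreover have "op_ran (Blinfun (orth_proj B)) = complex_vector.span B"
  proof
    show "op_ran (Blinfun (orth_proj B)) \<subseteq> complex_vector.span B"
      by (auto simp: op_ran_def P orth_proj_in_span)
    show "complex_vector.span B \<subseteq> op_ran (Blinfun (orth_proj B))"
      unfolding op_ran_def P using orth_proj_eq[OF assms] by (metis rangeI subsetI)
  qed
  ultimately show ?thesis using that by blast
qed

text \<open>\<open>D\<close> is the regular part \<open>(z - z\<^sub>0)\<^sup>n A(z)\<^sup>-\<^sup>1\<close> of the inverse.\<close>

definition inverse_pole :: "complex set \<Rightarrow> complex \<Rightarrow> (complex \<Rightarrow> 'a::chilbert_space \<Rightarrow>\<^sub>L 'a) \<Rightarrow> nat \<Rightarrow> bool"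
  where "inverse_pole \<Omega> z\<^sub>0 A n \<longleftrightarrow> (\<forall>z\<in>\<Omega>. op_analytic_at A z) \<and> finite_cdim (op_ker (A z\<^sub>0)) \<and>
    (\<exists>D. op_analytic_at D z\<^sub>0 \<and> D z\<^sub>0 \<noteq> 0 \<and>
      (\<forall>\<^sub>F w in at z\<^sub>0. (A w o\<^sub>L D w) = (w - z\<^sub>0) ^ n *\<^sub>C id_blinfun \<and>
        (D w o\<^sub>L A w) = (w - z\<^sub>0) ^ n *\<^sub>C id_blinfun))"

text \<open>Continuity carries the identity into the excluded point. The power \<open>0 ^ n\<close>
  serves both uses: it is 0 at a genuine pole and 1 when \<open>n = 0\<close>.\<close>

lemma inverse_pole_at_center:
  fixes A D :: "complex \<Rightarrow> 'a::chilbert_space \<Rightarrow>\<^sub>L 'a"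
  assumes "op_analytic_at A z" "op_analytic_at D z"
    and "\<forall>\<^sub>F w in at z. (A w o\<^sub>L D w) = (w - z) ^ n *\<^sub>C id_blinfun"
  shows "(A z o\<^sub>L D z) = 0 ^ n *\<^sub>C id_blinfun"
proof -
  have "((\<lambda>w. A w o\<^sub>L D w) \<longlongrightarrow> (A z o\<^sub>L D z)) (at z)"
    using assms(1,2)
    by (intro bounded_bilinear.tendsto[OF bounded_bilinear_blinfun_compose] op_analytic_at_tendsto)
  moreover have "((\<lambda>w. (w - z) ^ n *\<^sub>C (id_blinfun :: 'a \<Rightarrow>\<^sub>L 'a)) \<longlongrightarrow> (z - z) ^ n *\<^sub>C id_blinfun) (at z)"
    by (intro bounded_linear.tendsto[OF bounded_linear_scaleC_left] tendsto_intros)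
  then have "((\<lambda>w. A w o\<^sub>L D w) \<longlongrightarrow> (z - z) ^ n *\<^sub>C id_blinfun) (at z)"
    by (rule Lim_transform_eventually) (use assms(3) in \<open>auto elim: eventually_mono\<close>)
  ultimately show ?thesis using tendsto_unique[OF at_neq_bot] by fastforce
qed

text \<open>As the range of \<open>P\<close> is the kernel of \<open>A z\<^sub>0\<close>, the
  comparison of the two kernels turns into one of consecutive ranks when splittings are
  chained.\<close>

definition splits_off :: "complex set \<Rightarrow> complex \<Rightarrow> (complex \<Rightarrow> 'a::chilbert_space \<Rightarrow>\<^sub>L 'a) \<Rightarrow>
    (complex \<Rightarrow> 'a \<Rightarrow>\<^sub>L 'a) \<Rightarrow> ('a \<Rightarrow>\<^sub>L 'a) \<Rightarrow> bool"
  where "splits_off \<Omega> z\<^sub>0 A A' P \<longleftrightarrow>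
    P \<in> projections \<and> op_ran P = op_ker (A z\<^sub>0) \<and> finite_cdim (op_ran P) \<and>
    (\<forall>z\<in>\<Omega>. A z = (A' z o\<^sub>L ((id_blinfun - P) - (z - z\<^sub>0) *\<^sub>C P))) \<and>
    complex_vector.dim (op_ker (A' z\<^sub>0)) \<le> complex_vector.dim (op_ker (A z\<^sub>0)) \<and>
    1 \<le> complex_vector.dim (op_ker (A z\<^sub>0))"

text \<open>The inverse of \<open>A'\<close> is the factor times the inverse of \<open>A\<close>, so
  the new regular part is \<open>inverse (w - z\<^sub>0) *\<^sub>C Q (D w) - P (D w)\<close>. Its
  first summand has no pole, because \<open>D z\<^sub>0\<close> maps into the range of
  \<open>P\<close>; the second keeps the value at the center nonzero, because \<open>P\<close> fixes
  the values of \<open>D z\<^sub>0\<close>.\<close>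

lemma inverse_pole_splits_off:
  fixes A :: "complex \<Rightarrow> 'a::chilbert_space \<Rightarrow>\<^sub>L 'a"
  assumes pole: "inverse_pole \<Omega> z\<^sub>0 A (Suc n)" and z0: "z\<^sub>0 \<in> \<Omega>"
  obtains A' P where "inverse_pole \<Omega> z\<^sub>0 A' n" "splits_off \<Omega> z\<^sub>0 A A' P"
proof -
  have an: "\<forall>z\<in>\<Omega>. op_analytic_at A z" and fin: "finite_cdim (op_ker (A z\<^sub>0))"
    using pole by (auto simp: inverse_pole_def)
  obtain D where D: "op_analytic_at D z\<^sub>0" "D z\<^sub>0 \<noteq> 0"
    and AD: "\<forall>\<^sub>F w in at z\<^sub>0. (A w o\<^sub>L D w) = (w - z\<^sub>0) ^ Suc n *\<^sub>C id_blinfun \<and>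
        (D w o\<^sub>L A w) = (w - z\<^sub>0) ^ Suc n *\<^sub>C id_blinfun"
    using pole unfolding inverse_pole_def by blast
  have A_ops: "A z \<in> bounded_ops" if "z \<in> \<Omega>" for z
    using an that op_analytic_at_bounded_ops by blast
  have "(A z\<^sub>0 o\<^sub>L D z\<^sub>0) = 0 ^ Suc n *\<^sub>C id_blinfun"
    by (rule inverse_pole_at_center) (use an z0 D AD in \<open>auto elim: eventually_mono\<close>)
  then have "(A z\<^sub>0 o\<^sub>L D z\<^sub>0) = 0" by simp
  then have AD0: "A z\<^sub>0 (D z\<^sub>0 x) = 0" for x
    by (metis blinfun_apply_blinfun_compose zero_blinfun.rep_eq)
  obtain B where B: "finite B" "orthonormal B" "complex_vector.span B = op_ker (A z\<^sub>0)"
    "complex_vector.dim (op_ker (A z\<^sub>0)) = card B"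
    using orthonormal_basis_exists[OF op_ker_subspace[OF A_ops[OF z0]] fin] .
  obtain P where P: "P \<in> projections" "op_ran P = op_ker (A z\<^sub>0)"
    using orth_proj_operator[OF B(1,2)] B(3) by metis
  define Q where "Q = id_blinfun - P"
  have P_ops: "P \<in> bounded_ops" and PP: "P (P x) = P x" for x
    using P(1) by (auto simp: projections_def) (metis blinfun_apply_blinfun_compose)
  have Q_ops: "Q \<in> bounded_ops" unfolding Q_def by (intro bounded_ops_diff bounded_ops_id P_ops)
  have Q_apply: "Q x = x - P x" for x by (simp add: Q_def blinfun.diff_left)
  have PQ: "P (Q x) = 0" "Q (P x) = 0" "Q (Q x) = Q x" for x
    by (simp_all add: Q_apply blinfun.diff_right PP)
  note lin = blinfun.diff_right blinfun.add_right blinfun.zero_right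
    bounded_ops_scaleC[OF P_ops] bounded_ops_scaleC[OF Q_ops]
  have AP0: "A z\<^sub>0 (P x) = 0" for x
    using P(2) by (auto simp: op_ran_def op_ker_def)
  have P_ker: "P x = x" if "A z\<^sub>0 x = 0" for x
  proof -
    have "x \<in> op_ran P" using that P(2) by (simp add: op_ker_def)
    then show ?thesis by (auto simp: op_ran_def PP)
  qed
  have QD0: "Q (D z\<^sub>0 x) = 0" for x using P_ker[OF AD0] by (simp add: Q_apply)

  have "\<forall>z\<in>\<Omega>. op_analytic_at (\<lambda>w. A w o\<^sub>L P) z"
    using an P_ops op_analytic_at_compose_right by blast
  moreover have "(A z\<^sub>0 o\<^sub>L P) = 0" by (rule blinfun_eqI) (simp add: AP0)
  ultimately obtain G where G: "\<forall>z\<in>\<Omega>. op_analytic_at G z"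
    "\<And>w. w \<noteq> z\<^sub>0 \<Longrightarrow> G w = inverse (w - z\<^sub>0) *\<^sub>C (A w o\<^sub>L P)"
    using op_analytic_divide[of \<Omega> "\<lambda>w. A w o\<^sub>L P" z\<^sub>0] z0 by blast
  \<comment> \<open>The further \<open>P\<close> changes nothing off the center. At the center it
    removes the \<open>G\<close> term wherever \<open>P x = 0\<close>, which serves both the
    factorization at \<open>z\<^sub>0\<close> and the injectivity of \<open>P\<close> on the new
    kernel.\<close>
  define A' where "A' w = (A w o\<^sub>L Q) - (G w o\<^sub>L P)" for w
  have A'_apply: "A' w x = A w (Q x) - G w (P x)" for w x by (simp add: A'_def blinfun.diff_left)
  have G_apply: "G w (P x) = inverse (w - z\<^sub>0) *\<^sub>C A w (P x)" if "w \<noteq> z\<^sub>0" for w x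
    using that by (simp add: G(2) blinfun_apply_scaleC PP)
  have an': "\<forall>z\<in>\<Omega>. op_analytic_at A' z"
    unfolding A'_def
    using an G(1) P_ops Q_ops by (auto intro!: op_analytic_at_diff op_analytic_at_compose_right)
  have fact: "A z = (A' z o\<^sub>L (Q - (z - z\<^sub>0) *\<^sub>C P))" if z: "z \<in> \<Omega>" for z
  proof (rule blinfun_eqI)
    fix x
    define y where "y = (Q - (z - z\<^sub>0) *\<^sub>C P) x"
    have "y = Q x - (z - z\<^sub>0) *\<^sub>C P x" by (simp add: y_def blinfun.diff_left blinfun_apply_scaleC)
    then have y: "Q y = Q x" "P y = - ((z - z\<^sub>0) *\<^sub>C P x)" by (simp_all add: lin PQ PP)
    have "A' z y = A z (Q x) + A z (P x)"
    proof (cases "z = z\<^sub>0")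
      case True
      then show ?thesis by (simp add: A'_apply y AP0 blinfun.zero_right)
    next
      case False
      have "G z (P y) = inverse (z - z\<^sub>0) *\<^sub>C A z (P y)"
        using G_apply[OF False, of y] .
      also have "\<dots> = - A z (P x)"
        using False by (simp add: y blinfun.minus_right bounded_ops_scaleC[OF A_ops[OF z]])
      finally show ?thesis by (simp add: A'_apply y)
    qed
    also have "\<dots> = A z x" by (simp add: Q_apply blinfun.diff_right)
    finally show "A z x = (A' z o\<^sub>L (Q - (z - z\<^sub>0) *\<^sub>C P)) x" by (simp add: y_def)
  qed

  have "op_analytic_at (\<lambda>w. Q o\<^sub>L D w) z\<^sub>0" by (intro op_analytic_at_compose_left D Q_ops)
  moreover have "(Q o\<^sub>L D z\<^sub>0) = 0" by (rule blinfun_eqI) (simp add: QD0)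
  ultimately obtain E where E: "op_analytic_at E z\<^sub>0"
    "\<And>w. w \<noteq> z\<^sub>0 \<Longrightarrow> E w = inverse (w - z\<^sub>0) *\<^sub>C (Q o\<^sub>L D w)"
    using op_analytic_at_divide_center[of "\<lambda>w. Q o\<^sub>L D w" z\<^sub>0] by blast
  define D' where "D' w = (Q o\<^sub>L E w) - (P o\<^sub>L D w)" for w
  have D'_apply: "D' w x = Q (E w x) - P (D w x)" for w x by (simp add: D'_def blinfun.diff_left)
  have D'_an: "op_analytic_at D' z\<^sub>0"
    unfolding D'_def by (intro op_analytic_at_diff op_analytic_at_compose_left E D P_ops Q_ops)
  have D'_ne: "D' z\<^sub>0 \<noteq> 0"
  proof
    assume "D' z\<^sub>0 = 0"
    then have "P (D' z\<^sub>0 x) = 0" for x by (simp add: blinfun.zero_right)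
    then have "P (D z\<^sub>0 x) = 0" for x by (simp add: D'_apply lin PQ PP)
    then have "D z\<^sub>0 x = 0" for x using P_ker[OF AD0] by metis
    then show False using D(2) by (metis blinfun_eqI zero_blinfun.rep_eq)
  qed
  have A_ops_ev: "\<forall>\<^sub>F w in at z\<^sub>0. A w \<in> bounded_ops" "\<forall>\<^sub>F w in at z\<^sub>0. D w \<in> bounded_ops"
    using op_analytic_at_eventually_bounded_ops[of A z\<^sub>0] an z0
      op_analytic_at_eventually_bounded_ops[OF D(1)] by (auto simp: eventually_at_filter elim: eventually_mono)
  have "\<forall>\<^sub>F w in at z\<^sub>0. (A' w o\<^sub>L D' w) = (w - z\<^sub>0) ^ n *\<^sub>C id_blinfun \<and>
        (D' w o\<^sub>L A' w) = (w - z\<^sub>0) ^ n *\<^sub>C id_blinfun"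
    using AD A_ops_ev eventually_neq_at_within[of z\<^sub>0 z\<^sub>0 UNIV]
  proof eventually_elim
    case (elim w)
    define c where "c = w - z\<^sub>0"
    have c: "c \<noteq> 0" "w \<noteq> z\<^sub>0" using elim by (auto simp: c_def)
    have ADx: "A w (D w x) = c ^ Suc n *\<^sub>C x" "D w (A w x) = c ^ Suc n *\<^sub>C x" for x
      using elim unfolding c_def[symmetric]
      by (metis blinfun_apply_blinfun_compose blinfun_apply_scaleC blinfun_apply_id_blinfun)+
    have A'x: "A' w x = A w (Q x - inverse c *\<^sub>C P x)" for x
      by (simp add: A'_apply G_apply[OF c(2)] c_def blinfun.diff_right bounded_ops_scaleC[OF elim(2)])
    have D'x: "D' w x = inverse c *\<^sub>C Q (D w x) - P (D w x)" for x
      by (simp add: D'_apply E(2)[OF c(2)] blinfun_apply_scaleC lin PQ flip: c_def)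
    have "A' w (D' w x) = c ^ n *\<^sub>C x" for x
    proof -
      define y where "y = D w x"
      have "Q (D' w x) - inverse c *\<^sub>C P (D' w x) = inverse c *\<^sub>C (Q y + P y)"
        by (simp add: D'x lin PQ PP complex_vector.scale_right_distrib flip: y_def)
      also have "Q y + P y = y" by (simp add: Q_apply)
      finally have "A' w (D' w x) = inverse c *\<^sub>C A w y"
        by (simp add: A'x bounded_ops_scaleC[OF elim(2)])
      then show ?thesis using c by (simp add: y_def ADx)
    qed
    moreover have "D' w (A' w x) = c ^ n *\<^sub>C x" for x
    proof -
      have "D w (A' w x) = c ^ Suc n *\<^sub>C (Q x - inverse c *\<^sub>C P x)" by (simp only: A'x ADx)
      moreover have "inverse c * c ^ Suc n = c ^ n" "c ^ Suc n * inverse c = c ^ n"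
        using c by simp_all
      ultimately have "D' w (A' w x) = c ^ n *\<^sub>C (Q x + P x)"
        by (simp add: D'x lin PQ PP scaleC_scaleC complex_vector.scale_right_distrib del: power_Suc)
      then show ?thesis by (simp add: Q_apply)
    qed
    ultimately show ?case
      by (auto simp: blinfun_apply_scaleC c_def intro!: blinfun_eqI)
  qed
  moreover have ker': "finite_cdim (op_ker (A' z\<^sub>0))"
    "complex_vector.dim (op_ker (A' z\<^sub>0)) \<le> complex_vector.dim (op_ker (A z\<^sub>0))"
  proof -
    have "A' z\<^sub>0 \<in> bounded_ops" using an' z0 op_analytic_at_bounded_ops by blast
    note sub = op_ker_subspace[OF this] op_ker_subspace[OF A_ops[OF z0]]
    have to: "P x \<in> op_ker (A z\<^sub>0)" for x by (simp add: op_ker_def AP0)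
    \<comment> \<open>When \<open>P x = 0\<close>, the operators \<open>A' z\<^sub>0\<close> and
      \<open>A z\<^sub>0\<close> agree at \<open>x\<close>; so \<open>x\<close> lies in the kernel
      of \<open>A z\<^sub>0\<close>, which \<open>P\<close> fixes pointwise.\<close>
    have inj: "x = 0" if "x \<in> op_ker (A' z\<^sub>0)" "P x = 0" for x
    proof -
      have "A z\<^sub>0 x = 0" using that by (simp add: op_ker_def A'_apply Q_apply blinfun.zero_right)
      then show ?thesis using P_ker that(2) by simp
    qed
    show "finite_cdim (op_ker (A' z\<^sub>0))"
      by (rule dim_le_of_injective(1)[OF P_ops sub fin to inj])
    show "complex_vector.dim (op_ker (A' z\<^sub>0)) \<le> complex_vector.dim (op_ker (A z\<^sub>0))"
      by (rule dim_le_of_injective(2)[OF P_ops sub fin to inj])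
  qed
  ultimately have "inverse_pole \<Omega> z\<^sub>0 A' n"
    unfolding inverse_pole_def using an' D'_an D'_ne by blast
  moreover have "1 \<le> complex_vector.dim (op_ker (A z\<^sub>0))"
  proof -
    obtain x where "D z\<^sub>0 x \<noteq> 0" using D(2) by (metis blinfun_eqI zero_blinfun.rep_eq)
    moreover have "D z\<^sub>0 x \<in> complex_vector.span B" using B(3) AD0 by (simp add: op_ker_def)
    ultimately have "B \<noteq> {}" by auto
    then show ?thesis using B(1,4) by (simp add: Suc_le_eq card_gt_0_iff)
  qed
  then have "splits_off \<Omega> z\<^sub>0 A A' P"
    unfolding splits_off_def Q_def[symmetric] using P fin fact ker'(2) by simp
  ultimately show ?thesis using that by blast
qed

section \<open>From the Laurent expansion to the regular part of the inverse\<close>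

lemma is_inverse_unique: "is_inverse T S \<Longrightarrow> is_inverse T S' \<Longrightarrow> S = S'"
  by (rule blinfun_eqI) (metis is_inverse_apply)

lemma op_inverse_is_inverse: "boundedly_invertible T \<Longrightarrow> is_inverse T (op_inverse T)"
  unfolding op_inverse_def boundedly_invertible_def
  by (rule theI') (use is_inverse_unique in blast)

lemma inverse_pole_of_order_imp:
  fixes A :: "complex \<Rightarrow> 'a::chilbert_space \<Rightarrow>\<^sub>L 'a"
  assumes "inverse_pole_of_order A z\<^sub>0 n" "\<forall>z\<in>\<Omega>. op_analytic_at A z" "z\<^sub>0 \<in> \<Omega>"
    and "finite_cdim (op_ker (A z\<^sub>0))"
  shows "0 < n" "inverse_pole \<Omega> z\<^sub>0 A n"
proof -
  show "0 < n" using assms(1) by (simp add: inverse_pole_of_order_def op_pole_of_order_def)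
  have inv: "\<forall>\<^sub>F w in at z\<^sub>0. boundedly_invertible (A w)"
    using assms(1) by (simp add: inverse_pole_of_order_def)
  obtain r C where C: "r > 0" "range C \<subseteq> bounded_ops" "C 0 \<noteq> 0"
    "\<forall>w\<in>ball z\<^sub>0 r - {z\<^sub>0}. (\<lambda>k. (w - z\<^sub>0) powi (int k - int n) *\<^sub>C C k) sums op_inverse (A w)"
    using assms(1) unfolding inverse_pole_of_order_def op_pole_of_order_def by blast
  \<comment> \<open>The singularity is removable, and the leading coefficient \<open>C 0\<close>
    fills it; that it is nonzero expresses the exactness of the order.\<close>
  define D where "D w = (if w = z\<^sub>0 then C 0 else (w - z\<^sub>0) ^ n *\<^sub>C op_inverse (A w))" for w
  have "op_analytic_at D z\<^sub>0"
  proof (rule op_analytic_atI[of r C])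
    fix w assume w: "w \<in> ball z\<^sub>0 r"
    show "(\<lambda>k. (w - z\<^sub>0) ^ k *\<^sub>C C k) sums D w"
    proof (cases "w = z\<^sub>0")
      case True
      then show ?thesis using power_series_center[of z\<^sub>0 C] by (simp add: D_def)
    next
      case False
      have "(w - z\<^sub>0) ^ n * (w - z\<^sub>0) powi (int k - int n) = (w - z\<^sub>0) ^ k" for k
        using False by (simp add: power_int_diff)
      then show ?thesis
        using sums_scaleC[of _ "op_inverse (A w)" "(w - z\<^sub>0) ^ n"] C(4) w False
        by (fastforce simp: D_def)
    qed
  qed (use C in auto)
  moreover have "D z\<^sub>0 \<noteq> 0" using C(3) by (simp add: D_def)
  moreover have "\<forall>\<^sub>F w in at z\<^sub>0. A w \<in> bounded_ops"
    using assms(2,3) op_analytic_at_eventually_bounded_ops[of A z\<^sub>0]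
    by (auto simp: eventually_at_filter elim: eventually_mono)
  with inv eventually_neq_at_within[of z\<^sub>0 z\<^sub>0 UNIV]
  have "\<forall>\<^sub>F w in at z\<^sub>0. (A w o\<^sub>L D w) = (w - z\<^sub>0) ^ n *\<^sub>C id_blinfun \<and>
        (D w o\<^sub>L A w) = (w - z\<^sub>0) ^ n *\<^sub>C id_blinfun"
  proof eventually_elim
    case (elim w)
    then show ?case
      using op_inverse_is_inverse[OF elim(1)]
      by (simp add: D_def is_inverse_def blinfun_compose_scaleC_left blinfun_compose_scaleC_right)
  qed
  ultimately show "inverse_pole \<Omega> z\<^sub>0 A n"
    unfolding inverse_pole_def using assms(2,4) by blast
qed

section \<open>The product of the factors\<close>

lemma projections_bounded_ops: "P \<in> projections \<Longrightarrow> P \<in> bounded_ops"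
  by (simp add: projections_def)

lemma projection_idem: "P \<in> projections \<Longrightarrow> P (P x) = P x"
  by (auto simp: projections_def) (metis blinfun_apply_blinfun_compose)

lemma complement_projection:
  assumes "P \<in> projections"
  shows "id_blinfun - P \<in> projections"
  using projections_bounded_ops[OF assms] projection_idem[OF assms]
  by (auto simp: projections_def bounded_ops_diff bounded_ops_id blinfun.diff_left blinfun.diff_right
      intro!: blinfun_eqI)

lemma factor_bounded_ops:
  "P \<in> projections \<Longrightarrow> (id_blinfun - P) - c *\<^sub>C P \<in> bounded_ops"
  by (intro bounded_ops_diff bounded_ops_id bounded_ops_scale projections_bounded_ops)

text \<open>\<open>P\<close> and its complement annihilate each other; the factor acts as the scalar
  -c on the range of \<open>P\<close> and as the identity on its kernel.\<close>

lemma factor_is_inverse: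
  assumes P: "P \<in> projections" and c: "c \<noteq> 0"
  shows "is_inverse ((id_blinfun - P) - c *\<^sub>C P) ((id_blinfun - P) - inverse c *\<^sub>C P)"
  using c projection_idem[OF P] bounded_ops_scaleC[OF projections_bounded_ops[OF P]]
    factor_bounded_ops[OF P]
  by (auto simp: is_inverse_def blinfun.diff_left blinfun.diff_right blinfun_apply_scaleC
      intro!: blinfun_eqI)

lemma is_inverse_compose:
  assumes "is_inverse S S'" "is_inverse T T'"
  shows "is_inverse (S o\<^sub>L T) (T' o\<^sub>L S')"
  using is_inverse_apply[OF assms(1)] is_inverse_apply[OF assms(2)] assms
  by (auto simp: is_inverse_def bounded_ops_compose intro!: blinfun_eqI)

lemma factor_prod_invertible:
  assumes "\<And>j. j \<in> {1..n} \<Longrightarrow> P j \<in> projections" and "c \<noteq> 0"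
    and "\<And>j. j \<in> {1..n} \<Longrightarrow> Q j = id_blinfun - P j"
  shows "factor_prod P Q c n \<in> bounded_ops \<and> (\<exists>G. G \<in> bounded_ops \<and>
    is_inverse (factor_prod P Q c n) G \<and> is_inverse G (factor_prod P Q c n))"
  using assms(1,3)
proof (induction n)
  case 0
  show ?case
    by (auto simp: bounded_ops_id is_inverse_def intro!: exI[of _ id_blinfun] blinfun_eqI)
next
  case (Suc n)
  obtain G where G: "factor_prod P Q c n \<in> bounded_ops" "G \<in> bounded_ops"
    "is_inverse (factor_prod P Q c n) G"
    using Suc by fastforce
  have P: "P (Suc n) \<in> projections" "Q (Suc n) = id_blinfun - P (Suc n)" using Suc.prems by simp_all
  let ?F = "factor_prod P Q c (Suc n)"
  let ?G = "G o\<^sub>L ((id_blinfun - P (Suc n)) - inverse c *\<^sub>C P (Suc n))"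
  have F: "?F \<in> bounded_ops"
    using factor_bounded_ops[OF P(1), of c] by (simp add: bounded_ops_compose G P(2))
  moreover have inv: "is_inverse ?F ?G"
    using is_inverse_compose[OF factor_is_inverse[OF P(1) assms(2)] G(3)] by (simp add: P(2))
  ultimately show ?case by (metis is_inverse_def)
qed

text \<open>Each factor is \<open>id_blinfun - (1 + c) *\<^sub>C P j\<close>, and finite rank
  perturbations of the identity are closed under products.\<close>

lemma factor_prod_finite_rank:
  assumes "\<And>j. j \<in> {1..n} \<Longrightarrow> P j \<in> finite_rank_ops"
    and "\<And>j. j \<in> {1..n} \<Longrightarrow> Q j = id_blinfun - P j"
  shows "factor_prod P Q c n - id_blinfun \<in> finite_rank_ops"
  using assms
proof (induction n)
  case 0
  show ?case by (simp add: finite_rank_zero)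
next
  case (Suc n)
  define R where "R = factor_prod P Q c n - id_blinfun"
  have R: "R \<in> finite_rank_ops" unfolding R_def using Suc by simp
  have P: "P (Suc n) \<in> finite_rank_ops" "Q (Suc n) = id_blinfun - P (Suc n)" using Suc.prems by simp_all
  have "factor_prod P Q c (Suc n) - id_blinfun
      = R - ((1 + c) *\<^sub>C P (Suc n)) - ((1 + c) *\<^sub>C P (Suc n) o\<^sub>L R)"
    using scaleC_of_real[of 1]
    by (intro blinfun_eqI)
      (simp add: R_def P(2) blinfun.diff_left blinfun.diff_right blinfun.add_left
        blinfun_apply_scaleC scaleC_add_left complex_vector.scale_right_diff_distrib)
  also have "\<dots> \<in> finite_rank_ops"
    by (intro finite_rank_diff finite_rank_scale finite_rank_compose_right R P
        finite_rank_bounded_ops[OF R])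
  finally show ?case .
qed

text \<open>From I - BF = (I - B) - B(F - I), where the last term has finite rank. Only stability
  under finite rank summands is asked of \<open>X\<close>, so one argument serves the finite rank,
  Schatten and compact classes.\<close>

lemma perturbation_iff:
  assumes X: "\<And>T R. T \<in> X \<Longrightarrow> R \<in> finite_rank_ops \<Longrightarrow> T + R \<in> X"
    and B: "B \<in> bounded_ops" and F: "F - id_blinfun \<in> finite_rank_ops"
  shows "id_blinfun - (B o\<^sub>L F) \<in> X \<longleftrightarrow> id_blinfun - B \<in> X"
proof -
  define R where "R = (B o\<^sub>L (F - id_blinfun))"
  have R: "R \<in> finite_rank_ops" unfolding R_def by (intro finite_rank_compose_left B F)
  then have "0 - R \<in> finite_rank_ops" by (intro finite_rank_diff finite_rank_zero)
  moreover have "(B o\<^sub>L F) = B + R"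
    by (rule blinfun_eqI) (simp add: R_def blinfun.add_left blinfun.diff_left blinfun.diff_right)
  ultimately show ?thesis
    using X[OF _ R, of "id_blinfun - (B o\<^sub>L F)"] X[of "id_blinfun - B" "0 - R"]
    by (auto simp: algebra_simps)
qed

text \<open>At order zero \<open>D\<close> is an inverse off the center, and continuity of both
  products makes it one at the center too.\<close>

lemma inverse_pole_zero:
  assumes "inverse_pole \<Omega> z\<^sub>0 A 0" "z\<^sub>0 \<in> \<Omega>"
  shows "\<forall>\<^sub>F w in nhds z\<^sub>0. boundedly_invertible (A w)"
proof -
  obtain D where D: "op_analytic_at D z\<^sub>0" and A: "op_analytic_at A z\<^sub>0"
    and AD: "\<forall>\<^sub>F w in at z\<^sub>0. (A w o\<^sub>L D w) = id_blinfun \<and> (D w o\<^sub>L A w) = id_blinfun"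
    using assms scaleC_of_real[of 1 id_blinfun] by (auto simp: inverse_pole_def)
  have "(A z\<^sub>0 o\<^sub>L D z\<^sub>0) = 0 ^ 0 *\<^sub>C id_blinfun"
    by (rule inverse_pole_at_center[OF A D]) (use AD in \<open>auto elim: eventually_mono\<close>)
  moreover have "(D z\<^sub>0 o\<^sub>L A z\<^sub>0) = 0 ^ 0 *\<^sub>C id_blinfun"
    by (rule inverse_pole_at_center[OF D A]) (use AD in \<open>auto elim: eventually_mono\<close>)
  ultimately have "\<forall>\<^sub>F w in nhds z\<^sub>0. (A w o\<^sub>L D w) = id_blinfun \<and> (D w o\<^sub>L A w) = id_blinfun"
    using AD by (simp add: eventually_nhds_conv_at)
  with op_analytic_at_eventually_bounded_ops[OF D] show ?thesis
    by eventually_elim (auto simp: boundedly_invertible_def is_inverse_def)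
qed

lemma iterated_splitting:
  fixes A :: "complex \<Rightarrow> 'a::chilbert_space \<Rightarrow>\<^sub>L 'a"
  assumes "inverse_pole \<Omega> z\<^sub>0 A n" "z\<^sub>0 \<in> \<Omega>"
  obtains As P where "As 0 = A" "inverse_pole \<Omega> z\<^sub>0 (As n) 0"
    "\<And>k. k < n \<Longrightarrow> splits_off \<Omega> z\<^sub>0 (As k) (As (Suc k)) (P k)"
proof -
  \<comment> \<open>Beyond \<open>n\<close> the guards make the requirements empty, so that
    dependent choice can run over all natural numbers.\<close>
  have "\<exists>As. \<forall>k. ((k = 0 \<longrightarrow> As k = A) \<and> (k \<le> n \<longrightarrow> inverse_pole \<Omega> z\<^sub>0 (As k) (n - k))) \<and>
      (k < n \<longrightarrow> (\<exists>P. splits_off \<Omega> z\<^sub>0 (As k) (As (Suc k)) P))"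
  proof (rule dependent_nat_choice)
    show "\<exists>X. (0 = (0::nat) \<longrightarrow> X = A) \<and> (0 \<le> n \<longrightarrow> inverse_pole \<Omega> z\<^sub>0 X (n - 0))"
      using assms(1) by simp
    fix X :: "complex \<Rightarrow> 'a \<Rightarrow>\<^sub>L 'a" and k
    assume X: "(k = 0 \<longrightarrow> X = A) \<and> (k \<le> n \<longrightarrow> inverse_pole \<Omega> z\<^sub>0 X (n - k))"
    show "\<exists>Y. ((Suc k = 0 \<longrightarrow> Y = A) \<and> (Suc k \<le> n \<longrightarrow> inverse_pole \<Omega> z\<^sub>0 Y (n - Suc k))) \<and>
        (k < n \<longrightarrow> (\<exists>P. splits_off \<Omega> z\<^sub>0 X Y P))"
    proof (cases "k < n")
      case True
      then have "inverse_pole \<Omega> z\<^sub>0 X (Suc (n - Suc k))" using X by (simp add: Suc_diff_Suc)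
      from inverse_pole_splits_off[OF this assms(2)] show ?thesis by blast
    qed auto
  qed
  then obtain As where As: "\<And>k. k = 0 \<longrightarrow> As k = A" "\<And>k. k \<le> n \<longrightarrow> inverse_pole \<Omega> z\<^sub>0 (As k) (n - k)"
    "\<And>k. k < n \<longrightarrow> (\<exists>P. splits_off \<Omega> z\<^sub>0 (As k) (As (Suc k)) P)"
    by blast
  then obtain P where "\<And>k. k < n \<Longrightarrow> splits_off \<Omega> z\<^sub>0 (As k) (As (Suc k)) (P k)" by metis
  then show ?thesis using that[of As P] As(1)[of 0] As(2)[of n] by simp
qed

theorem theorem3p8:
  fixes A :: "complex \<Rightarrow> 'a::chilbert_space \<Rightarrow>\<^sub>L 'a"
    and \<Omega> :: "complex set" and z\<^sub>0 :: complex and n\<^sub>0 :: nat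
  assumes separable: "separable_space (euclidean :: 'a topology)"
    and "open \<Omega>" and "connected \<Omega>"
    and "op_analytic_on A \<Omega>"
    and "\<forall>z\<in>\<Omega>. A z \<in> fredholm_ops"
    and "z\<^sub>0 \<in> \<Omega>"
    and "inverse_pole_of_order A z\<^sub>0 n\<^sub>0"
  shows "\<exists>(P :: nat \<Rightarrow> 'a \<Rightarrow>\<^sub>L 'a) (Q :: nat \<Rightarrow> 'a \<Rightarrow>\<^sub>L 'a) (A' :: complex \<Rightarrow> 'a \<Rightarrow>\<^sub>L 'a) (p :: nat \<Rightarrow> nat).
      (\<forall>j\<in>{1..n\<^sub>0}. P j \<in> projections \<and> Q j \<in> projections \<and> Q j = id_blinfun - P j
          \<and> finite_cdim (op_ran (P j)) \<and> p j = complex_vector.dim (op_ran (P j)))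
    \<and> (\<forall>z\<in>\<Omega>. A z = A' z o\<^sub>L factor_prod P Q (z - z\<^sub>0) n\<^sub>0)
    \<and> 1 \<le> p n\<^sub>0 \<and> (\<forall>j\<in>{1..<n\<^sub>0}. p (Suc j) \<le> p j)
    \<and> op_analytic_on A' \<Omega>
    \<and> (\<forall>z\<in>\<Omega>. A' z \<in> fredholm_ops)
    \<and> (\<exists>\<epsilon>>0. \<forall>z\<in>\<Omega>. cmod (z - z\<^sub>0) < \<epsilon> \<longrightarrow> op_index (A z) = 0 \<and> op_index (A' z) = 0)
    \<and> (\<exists>\<epsilon>>0. \<forall>z\<in>\<Omega>. cmod (z - z\<^sub>0) < \<epsilon> \<longrightarrow> boundedly_invertible (A' z))
    \<and> p 1 = complex_vector.dim (op_ker (A z\<^sub>0)) \<and> p 1 = geo_mult 0 (A z\<^sub>0)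
    \<and> (\<Sum>j=1..n\<^sub>0. p j) \<ge> geo_mult 0 (A z\<^sub>0) \<and> (\<Sum>j=1..n\<^sub>0. p j) \<ge> n\<^sub>0
    \<and> ((\<forall>z\<in>\<Omega>. id_blinfun - A z \<in> finite_rank_ops)
         \<longleftrightarrow> (\<forall>z\<in>\<Omega>. id_blinfun - A' z \<in> finite_rank_ops))
    \<and> (\<forall>q\<ge>1. (\<forall>z\<in>\<Omega>. id_blinfun - A z \<in> schatten_ops q)
         \<longleftrightarrow> (\<forall>z\<in>\<Omega>. id_blinfun - A' z \<in> schatten_ops q))
    \<and> ((\<forall>z\<in>\<Omega>. id_blinfun - A z \<in> compact_ops)
         \<longleftrightarrow> (\<forall>z\<in>\<Omega>. id_blinfun - A' z \<in> compact_ops))"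
proof -
  have an: "\<forall>z\<in>\<Omega>. op_analytic_at A z"
    using \<open>op_analytic_on A \<Omega>\<close> op_analytic_on_iff[OF \<open>open \<Omega>\<close>] by blast
  have "A z\<^sub>0 \<in> fredholm_ops" using \<open>\<forall>z\<in>\<Omega>. A z \<in> fredholm_ops\<close> \<open>z\<^sub>0 \<in> \<Omega>\<close> by blast
  then have "finite_cdim (op_ker (A z\<^sub>0))" by (simp add: fredholm_ops_def)
  note pole = inverse_pole_of_order_imp[OF \<open>inverse_pole_of_order A z\<^sub>0 n\<^sub>0\<close> an \<open>z\<^sub>0 \<in> \<Omega>\<close> this]
  obtain As P' where As: "As 0 = A" "inverse_pole \<Omega> z\<^sub>0 (As n\<^sub>0) 0"
    "\<And>k. k < n\<^sub>0 \<Longrightarrow> splits_off \<Omega> z\<^sub>0 (As k) (As (Suc k)) (P' k)"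
    using iterated_splitting[OF pole(2) \<open>z\<^sub>0 \<in> \<Omega>\<close>] by blast
  \<comment> \<open>The splitting steps are numbered from 0, the factors from 1.\<close>
  define P where "P j = P' (j - 1)" for j
  define Q where "Q j = id_blinfun - P j" for j
  define p where "p j = complex_vector.dim (op_ran (P j))" for j
  define A' where "A' = As n\<^sub>0"
  define F where "F z = factor_prod P Q (z - z\<^sub>0) n\<^sub>0" for z
  have split: "splits_off \<Omega> z\<^sub>0 (As (j - 1)) (As j) (P j)" if "j \<in> {1..n\<^sub>0}" for j
  proof -
    have "j - 1 < n\<^sub>0" "Suc (j - 1) = j" using that by auto
    then show ?thesis using As(3)[of "j - 1"] by (simp add: P_def)
  qed
  have P: "P j \<in> projections" "finite_cdim (op_ran (P j))" "P j \<in> finite_rank_ops"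
    if "j \<in> {1..n\<^sub>0}" for j
    using split[OF that] projections_bounded_ops by (auto simp: splits_off_def finite_rank_ops_def)
  have p_eq: "p j = complex_vector.dim (op_ker (As (j - 1) z\<^sub>0))" if "j \<in> {1..n\<^sub>0}" for j
    using split[OF that] by (simp add: splits_off_def p_def)
  have p_ge: "1 \<le> p j" if "j \<in> {1..n\<^sub>0}" for j
    using split[OF that] by (simp add: splits_off_def p_def)
  have p_mono: "p (Suc j) \<le> p j" if "j \<in> {1..<n\<^sub>0}" for j
    using split[of j] p_eq[of j] p_eq[of "Suc j"] that by (simp add: splits_off_def)
  have fact_k: "A z = (As k z o\<^sub>L factor_prod P Q (z - z\<^sub>0) k)" if "z \<in> \<Omega>" "k \<le> n\<^sub>0" for z k
    using that(2)
  proof (induction k)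
    case 0
    show ?case by (rule blinfun_eqI) (simp add: As(1))
  next
    case (Suc k)
    have "As k z = (As (Suc k) z o\<^sub>L (Q (Suc k) - (z - z\<^sub>0) *\<^sub>C P (Suc k)))"
      using split[of "Suc k"] Suc.prems that(1) by (simp add: splits_off_def Q_def)
    then show ?case using Suc by (intro blinfun_eqI) simp
  qed
  then have fact: "A z = (A' z o\<^sub>L F z)" if "z \<in> \<Omega>" for z using that by (simp add: A'_def F_def)
  have an': "op_analytic_on A' \<Omega>"
    using As(2) op_analytic_on_iff[OF \<open>open \<Omega>\<close>, of "As n\<^sub>0"] by (simp add: A'_def inverse_pole_def)
  have A'_ops: "A' z \<in> bounded_ops" if "z \<in> \<Omega>" for z
    using an' op_analytic_on_iff[OF \<open>open \<Omega>\<close>, of A'] op_analytic_at_bounded_ops that by blast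
  have F_fr: "F z - id_blinfun \<in> finite_rank_ops" for z
    unfolding F_def by (rule factor_prod_finite_rank) (use P in \<open>auto simp: Q_def\<close>)
  obtain \<epsilon> where \<epsilon>: "\<epsilon> > 0" "\<And>z. dist z z\<^sub>0 < \<epsilon> \<Longrightarrow> boundedly_invertible (A' z)"
    using inverse_pole_zero[OF As(2) \<open>z\<^sub>0 \<in> \<Omega>\<close>] unfolding eventually_nhds_metric A'_def by blast
  have index: "op_index (A z) = 0 \<and> op_index (A' z) = 0" if z: "z \<in> \<Omega>" "cmod (z - z\<^sub>0) < \<epsilon>" for z
  proof -
    obtain W where W: "is_inverse (A' z) W"
      using \<epsilon>(2)[of z] z(2) by (auto simp: boundedly_invertible_def dist_norm)
    have "A z = (A' z o\<^sub>L (id_blinfun + (F z - id_blinfun)))" using fact[OF z(1)] by simp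
    then show ?thesis
      using op_index_invertible_compose[OF A'_ops[OF z(1)] W F_fr[of z]]
        invertible_fredholm(2)[OF A'_ops[OF z(1)] W] by simp
  qed
  \<comment> \<open>At the center the factors are not invertible, but \<open>A'\<close> is.
    Elsewhere the product of the factors is invertible, and \<open>A'\<close> inherits the Fredholm
    property as \<open>A\<close> times its inverse.\<close>
  have fred': "A' z \<in> fredholm_ops" if z: "z \<in> \<Omega>" for z
  proof (cases "z = z\<^sub>0")
    case True
    then obtain W where "is_inverse (A' z) W" using \<epsilon>(1) \<epsilon>(2)[of z]
      by (auto simp: boundedly_invertible_def)
    then show ?thesis using invertible_fredholm(1)[OF A'_ops[OF z]] by blast
  next
    case False
    obtain G where G: "G \<in> bounded_ops" "is_inverse (F z) G" "is_inverse G (F z)"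
      using factor_prod_invertible[of n\<^sub>0 P "z - z\<^sub>0" Q] P(1) False unfolding F_def Q_def by auto
    have "A' z = (A z o\<^sub>L G)"
      by (rule blinfun_eqI) (simp add: fact[OF z] is_inverse_apply(2)[OF G(2)])
    then show ?thesis
      using fredholm_compose_invertible[OF _ G(1,3), of "A z"] \<open>\<forall>z\<in>\<Omega>. A z \<in> fredholm_ops\<close> z by simp
  qed
  have ideal: "(\<forall>z\<in>\<Omega>. id_blinfun - A z \<in> X) \<longleftrightarrow> (\<forall>z\<in>\<Omega>. id_blinfun - A' z \<in> X)"
    if "\<And>T R. T \<in> X \<Longrightarrow> R \<in> finite_rank_ops \<Longrightarrow> T + R \<in> X" for X
    using perturbation_iff[OF that A'_ops F_fr] fact by metis
  have n0: "1 \<in> {1..n\<^sub>0}" "n\<^sub>0 \<in> {1..n\<^sub>0}" using pole(1) by auto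
  have p1: "p 1 = complex_vector.dim (op_ker (A z\<^sub>0))" using p_eq[OF n0(1)] by (simp add: As(1))
  have geo: "geo_mult 0 (A z\<^sub>0) = complex_vector.dim (op_ker (A z\<^sub>0))" by (simp add: geo_mult_def)
  have sum1: "p 1 \<le> (\<Sum>j=1..n\<^sub>0. p j)" using n0(1) by (intro member_le_sum) auto
  have "(\<Sum>j=1..n\<^sub>0. 1) \<le> (\<Sum>j=1..n\<^sub>0. p j)" by (intro sum_mono p_ge)
  then have sum2: "n\<^sub>0 \<le> (\<Sum>j=1..n\<^sub>0. p j)" by simp
  have projs: "\<forall>j\<in>{1..n\<^sub>0}. P j \<in> projections \<and> Q j \<in> projections \<and> Q j = id_blinfun - P j
      \<and> finite_cdim (op_ran (P j)) \<and> p j = complex_vector.dim (op_ran (P j))"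
    using P by (auto simp: Q_def p_def intro: complement_projection)
  have schatten: "\<forall>q\<ge>1. (\<forall>z\<in>\<Omega>. id_blinfun - A z \<in> schatten_ops q)
      \<longleftrightarrow> (\<forall>z\<in>\<Omega>. id_blinfun - A' z \<in> schatten_ops q)"
    by (intro allI impI ideal schatten_add_finite_rank) auto
  show ?thesis
  proof (rule exI[of _ P], rule exI[of _ Q], rule exI[of _ A'], rule exI[of _ p], intro conjI)
    show "\<forall>z\<in>\<Omega>. A z = A' z o\<^sub>L factor_prod P Q (z - z\<^sub>0) n\<^sub>0" using fact by (simp add: F_def)
    show "\<exists>\<epsilon>>0. \<forall>z\<in>\<Omega>. cmod (z - z\<^sub>0) < \<epsilon> \<longrightarrow> op_index (A z) = 0 \<and> op_index (A' z) = 0"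
      using \<epsilon>(1) index by blast
    show "\<exists>\<epsilon>>0. \<forall>z\<in>\<Omega>. cmod (z - z\<^sub>0) < \<epsilon> \<longrightarrow> boundedly_invertible (A' z)"
      using \<epsilon> by (auto simp: dist_norm)
    show "(\<forall>z\<in>\<Omega>. id_blinfun - A z \<in> finite_rank_ops) \<longleftrightarrow> (\<forall>z\<in>\<Omega>. id_blinfun - A' z \<in> finite_rank_ops)"
      by (intro ideal finite_rank_add)
    show "(\<forall>z\<in>\<Omega>. id_blinfun - A z \<in> compact_ops) \<longleftrightarrow> (\<forall>z\<in>\<Omega>. id_blinfun - A' z \<in> compact_ops)"
      by (rule ideal, rule compact_ops_add, assumption, rule finite_rank_compact)
  qed (use projs p_ge[OF n0(2)] p_mono an' fred' p1 geo sum1 sum2 schatten in auto)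
qed

end
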